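(* For every $\alpha\in[3,\omega]$, the elementary theory $\mathbf{Th}(\mathsf{W}^N_\alpha,\prec,\Lambda,\langle\Diamond_i\mid i\in\mathbb{N},\ i\le\alpha\rangle)$ is undecidable.
   Context: Words are finite strings over the alphabet $\mathbb{N}=\{0,1,2,\dots\}$; $\mathsf{W}_\omega$ is the set of all words, $\Lambda$ the empty word, $AB$ concatenation. For $k\in\mathbb{N}$, $\mathsf{S}_k$ is the set of words all of whose symbols are $\ge k$; for $\alpha\in\mathbb{N}\cup\{\omega\}$, $\mathsf{W}_\alpha$ is the set of words all of whose symbols are $\le\alpha$. Given a linear preorder $\precsim$ with $A\sim B$ iff $A\precsim B\wedge B\precsim A$ and $A\prec B$ iff $A\precsim B\wedge\neg B\precsim A$, a finite sequence $(A_1,\dots,A_p)$ is lexicographically not greater than $(B_1,\dots,B_q)$ iff either $p\le q$ and $A_i\sim B_i$ for all $i\le p$, or there is $s<\min(p,q)$ with $A_i\sim B_i$ for $i\le s$ and $A_{s+1}\prec B_{s+1}$. A lexicographically maximal subsequence of a finite sequence is a subsequence that is lexicographically not less than every subsequence. The linear preorder $\precsim$ on $\mathsf{W}_\omega$ is defined by recursion on (largest symbol of $AB$) $-$ (smallest symbol of $AB$): $\Lambda\precsim\Lambda$; if $AB$ is nonempty with minimal symbol $n$, write uniquely $A=A_1n\cdots nA_k$, $B=B_1n\cdots nB_l$ ($k,l\ge1$) with $A_i,B_j\in\mathsf{S}_{n+1}$ (possibly empty); let $C,D$ be lexicographically maximal subsequences of $(A_1,\dots,A_k)$, $(B_1,\dots,B_l)$;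 then $A\precsim B$ iff $C$ is lexicographically not greater than $D$. The set $\mathsf{NF}$: $\Lambda\in\mathsf{NF}$; a word with minimal symbol $n$, written $A_1n\cdots nA_k$ with $k\ge2$, $A_i\in\mathsf{S}_{n+1}$, is in $\mathsf{NF}$ iff $A_k\precsim\dots\precsim A_1$ and all $A_i\in\mathsf{NF}$. Every word is $\sim$-equivalent to exactly one word of $\mathsf{NF}$; $\prec$ is a strict linear order on $\mathsf{NF}$. For $A\in\mathsf{NF}$, $\Diamond_nA$ is the unique word of $\mathsf{NF}$ equivalent to $An$. $\mathsf{W}^N_\alpha=\mathsf{W}_\alpha\cap\mathsf{NF}$. $\Lambda$ is a constant symbol. $\mathbf{Th}(\mathfrak{M})$ is the set of first-order sentences true in $\mathfrak{M}$; decidable means recursive. *)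

theory Defs
  imports Main "HOL-Library.Extended_Nat" "HOL-Library.Nat_Bijection"
begin

type_synonym word = "nat list"

definition spread :: "word \<Rightarrow> nat" where
  "spread w = (if w = [] then 0 else Max (set w) - Min (set w))"

fun splitn :: "nat \<Rightarrow> word \<Rightarrow> word list" where
  "splitn n [] = [[]]"
| "splitn n (x # xs) =
     (if x = n then [] # splitn n xs
      else (let r = splitn n xs in (x # hd r) # tl r))"

definition eqv :: "('a \<Rightarrow> 'a \<Rightarrow> bool) \<Rightarrow> 'a \<Rightarrow> 'a \<Rightarrow> bool" where
  "eqv r a b \<longleftrightarrow> r a b \<and> r b a"

definition strict :: "('a \<Rightarrow> 'a \<Rightarrow> bool) \<Rightarrow> 'a \<Rightarrow> 'a \<Rightarrow> bool" where
  "strict r a b \<longleftrightarrow> r a b \<and> \<not> r b a"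

definition lex_le :: "('a \<Rightarrow> 'a \<Rightarrow> bool) \<Rightarrow> 'a list \<Rightarrow> 'a list \<Rightarrow> bool" where
  "lex_le r xs ys \<longleftrightarrow>
     (length xs \<le> length ys \<and> (\<forall>i < length xs. eqv r (xs ! i) (ys ! i)))
   \<or> (\<exists>s < min (length xs) (length ys).
        (\<forall>i < s. eqv r (xs ! i) (ys ! i)) \<and> strict r (xs ! s) (ys ! s))"

definition lex_less :: "('a \<Rightarrow> 'a \<Rightarrow> bool) \<Rightarrow> 'a list \<Rightarrow> 'a list \<Rightarrow> bool" where
  "lex_less r xs ys \<longleftrightarrow> lex_le r xs ys \<and> \<not> lex_le r ys xs"

definition lexmax :: "('a \<Rightarrow> 'a \<Rightarrow> bool) \<Rightarrow> 'a list \<Rightarrow> 'a list \<Rightarrow> bool" where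
  "lexmax r L C \<longleftrightarrow> C \<in> set (subseqs L) \<and> (\<forall>D \<in> set (subseqs L). \<not> lex_less r C D)"

text \<open>One step of the recursive definition, given the preorder r on pairs of smaller spread.\<close>
definition le_step :: "(word \<Rightarrow> word \<Rightarrow> bool) \<Rightarrow> word \<Rightarrow> word \<Rightarrow> bool" where
  "le_step r A B =
     (if A @ B = [] then True
      else (let n = Min (set (A @ B));
                C = (SOME C. lexmax r (splitn n A) C);
                D = (SOME D. lexmax r (splitn n B) D)
            in lex_le r C D))"

primrec pre :: "nat \<Rightarrow> word \<Rightarrow> word \<Rightarrow> bool" where
  "pre 0 = (\<lambda>_ _. True)"
| "pre (Suc d) = le_step (pre d)"

definition wle :: "word \<Rightarrow> word \<Rightarrow> bool" where
  "wle A B = pre (Suc (spread (A @ B))) A B"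

definition wless :: "word \<Rightarrow> word \<Rightarrow> bool" where
  "wless A B \<longleftrightarrow> wle A B \<and> \<not> wle B A"

primrec nfk :: "nat \<Rightarrow> word \<Rightarrow> bool" where
  "nfk 0 w = (w = [])"
| "nfk (Suc d) w = (w = [] \<or>
     (let bs = splitn (Min (set w)) w in
        2 \<le> length bs \<and> successively (\<lambda>x y. wle y x) bs \<and> (\<forall>b \<in> set bs. nfk d b)))"

definition NF :: "word \<Rightarrow> bool" where
  "NF w = nfk (length w) w"

definition Dia :: "nat \<Rightarrow> word \<Rightarrow> word" where
  "Dia n A = (THE B. NF B \<and> wle B (A @ [n]) \<and> wle (A @ [n]) B)"

definition WN :: "enat \<Rightarrow> word set" where
  "WN \<alpha> = {w. NF w \<and> (\<forall>x \<in> set w. enat x \<le> \<alpha>)}"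

datatype trm = Var nat | Lam | Dm nat trm
datatype fm = Eq trm trm | Lt trm trm | Neg fm | Conj fm fm | Ex nat fm

primrec tval :: "(nat \<Rightarrow> word) \<Rightarrow> trm \<Rightarrow> word" where
  "tval e (Var x) = e x"
| "tval e Lam = []"
| "tval e (Dm i t) = Dia i (tval e t)"

primrec sat :: "enat \<Rightarrow> (nat \<Rightarrow> word) \<Rightarrow> fm \<Rightarrow> bool" where
  "sat \<alpha> e (Eq s t) = (tval e s = tval e t)"
| "sat \<alpha> e (Lt s t) = wless (tval e s) (tval e t)"
| "sat \<alpha> e (Neg \<phi>) = (\<not> sat \<alpha> e \<phi>)"
| "sat \<alpha> e (Conj \<phi> \<psi>) = (sat \<alpha> e \<phi> \<and> sat \<alpha> e \<psi>)"
| "sat \<alpha> e (Ex x \<phi>) = (\<exists>w \<in> WN \<alpha>. sat \<alpha> (e(x := w)) \<phi>)"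

primrec tvars :: "trm \<Rightarrow> nat set" where
  "tvars (Var x) = {x}"
| "tvars Lam = {}"
| "tvars (Dm i t) = tvars t"

primrec fvars :: "fm \<Rightarrow> nat set" where
  "fvars (Eq s t) = tvars s \<union> tvars t"
| "fvars (Lt s t) = tvars s \<union> tvars t"
| "fvars (Neg \<phi>) = fvars \<phi>"
| "fvars (Conj \<phi> \<psi>) = fvars \<phi> \<union> fvars \<psi>"
| "fvars (Ex x \<phi>) = fvars \<phi> - {x}"

primrec twf :: "enat \<Rightarrow> trm \<Rightarrow> bool" where
  "twf \<alpha> (Var x) = True"
| "twf \<alpha> Lam = True"
| "twf \<alpha> (Dm i t) = (enat i \<le> \<alpha> \<and> twf \<alpha> t)"

primrec fwf :: "enat \<Rightarrow> fm \<Rightarrow> bool" where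
  "fwf \<alpha> (Eq s t) = (twf \<alpha> s \<and> twf \<alpha> t)"
| "fwf \<alpha> (Lt s t) = (twf \<alpha> s \<and> twf \<alpha> t)"
| "fwf \<alpha> (Neg \<phi>) = fwf \<alpha> \<phi>"
| "fwf \<alpha> (Conj \<phi> \<psi>) = (fwf \<alpha> \<phi> \<and> fwf \<alpha> \<psi>)"
| "fwf \<alpha> (Ex x \<phi>) = fwf \<alpha> \<phi>"

definition Th :: "enat \<Rightarrow> fm set" where
  "Th \<alpha> = {\<phi>. fwf \<alpha> \<phi> \<and> fvars \<phi> = {} \<and> sat \<alpha> (\<lambda>_. []) \<phi>}"

primrec tcode :: "trm \<Rightarrow> nat" where
  "tcode (Var x) = prod_encode (0, x)"
| "tcode Lam = prod_encode (1, 0)"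
| "tcode (Dm i t) = prod_encode (2, prod_encode (i, tcode t))"

primrec fcode :: "fm \<Rightarrow> nat" where
  "fcode (Eq s t) = prod_encode (0, prod_encode (tcode s, tcode t))"
| "fcode (Lt s t) = prod_encode (1, prod_encode (tcode s, tcode t))"
| "fcode (Neg \<phi>) = prod_encode (2, fcode \<phi>)"
| "fcode (Conj \<phi> \<psi>) = prod_encode (3, prod_encode (fcode \<phi>, fcode \<psi>))"
| "fcode (Ex x \<phi>) = prod_encode (4, prod_encode (x, fcode \<phi>))"

datatype recf = Zf | Sf | Proj nat | Comp recf "recf list" | Prim recf recf | Mn recf

inductive reval :: "recf \<Rightarrow> nat list \<Rightarrow> nat \<Rightarrow> bool" where
  "reval Zf xs 0"
| "reval Sf (x # xs) (Suc x)"
| "i < length xs \<Longrightarrow> reval (Proj i) xs (xs ! i)"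
| "list_all2 (\<lambda>g y. reval g xs y) gs ys \<Longrightarrow> reval f ys y \<Longrightarrow> reval (Comp f gs) xs y"
| "reval f xs y \<Longrightarrow> reval (Prim f g) (0 # xs) y"
| "reval (Prim f g) (n # xs) z \<Longrightarrow> reval g (z # n # xs) y \<Longrightarrow> reval (Prim f g) (Suc n # xs) y"
| "reval f (y # xs) 0 \<Longrightarrow> (\<And>z. z < y \<Longrightarrow> \<exists>v. v \<noteq> 0 \<and> reval f (z # xs) v)
     \<Longrightarrow> reval (Mn f) xs y"

definition decidable_set :: "nat set \<Rightarrow> bool" where
  "decidable_set P \<longleftrightarrow> (\<exists>f. \<forall>n. reval f [n] (if n \<in> P then 1 else 0))"

end

theory Submission
  imports Defs "HOL-Library.Sublist"
begin

text \<open>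
  Write a normal form as a list of blocks separated by 0. Then \<open>z\<close> is an initial list of blocks of
  \<open>x\<close> iff \<open>z \<preceq> x \<prec> \<Diamond>\<^sub>1 z\<close>, and for such initial segments \<open>\<Diamond>\<^sub>1 \<Diamond>\<^sub>3 w = \<Diamond>\<^sub>1 z\<close> holds iff the
  last block of \<open>z\<close> is the normal form of the last block of \<open>w\<close> with 3 appended. So each initial
  segment of \<open>x\<close> points to at most one other. Taking as vertices those that are pointed at, and
  as edges leaving a vertex the pointers of the segments strictly between it and the next vertex,
  every finite directed graph whose edges increase a given linear order arises from some
  \<open>x\<close> over the symbols 0 to 3.

  In particular the graph of the bit relation (\<open>i\<close> is a binary digit of \<open>l\<close>) on
  \<open>{0, \<dots>, K - 1}\<close> arises, and this graph is finitely axiomatised by the rule for binary increment.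
  The bit relation is membership for hereditarily finite sets, so every recursive function is
  \<open>\<Sigma>\<^sub>1\<close>-definable over it. If the theory were decidable, some formula \<open>\<theta>(n)\<close> would say that
  the \<open>n\<close>-th formula, applied to its own code \<open>n\<close>, is not in the theory; applied to its own code, \<open>\<theta>\<close>
  contradicts itself.
\<close>

section \<open>The preorder on words and normal forms\<close>

text \<open>Appending 3 makes a block larger, so a pointer leads only to a larger block, that is, to
  a shorter initial segment, and each segment has just one pointer. A vertex with several edges
  therefore needs several blocks of its own, all lying between it and the next vertex and yet
  jumping to far targets. \<open>Ew K i l\<close> does this. Its first part
  \<open>Cw K (Suc i)\<close> fixes the position. Its second part \<open>Pw K l\<close> is, as a
  list of powers of 3, a proper prefix of every \<open>Cw K j\<close> with j at most l, so it is
  small enough to follow the first part in a normal form; a single 3 turns it into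
  \<open>Cw K (Suc l)\<close>, which is so large that the first part is dropped. Hence the four
  symbols: 0 separates blocks, 1 separates the parts of a block and gives the successor that cuts
  off initial segments, 2 separates the steps of a staircase, and 3 measures the steps. The
  sentences used can assert of a formula only that some finite bit structure satisfies it. This is
  an existential statement, and it suffices: the complement of a decidable theory is existentially
  definable too.\<close>

definition total_preorder :: "('a \<Rightarrow> 'a \<Rightarrow> bool) \<Rightarrow> bool" where
  "total_preorder r \<longleftrightarrow> (\<forall>a b. r a b \<or> r b a) \<and> transp r"

lemma total_preorder_refl: "total_preorder r \<Longrightarrow> r a a"
  by (auto simp: total_preorder_def)

lemma total_preorder_trans: "total_preorder r \<Longrightarrow> r a b \<Longrightarrow> r b c \<Longrightarrow> r a c"
  by (auto simp: total_preorder_def dest: transpD)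

lemma total_preorder_total: "total_preorder r \<Longrightarrow> r a b \<or> r b a"
  by (auto simp: total_preorder_def)

section \<open>Lexicographic comparison\<close>

lemma lex_le_Nil [simp]: "lex_le r [] ys"
  by (simp add: lex_le_def)

lemma lex_le_Cons_Nil [simp]: "\<not> lex_le r (x # xs) []"
  by (simp add: lex_le_def)

text \<open>Given \<open>r x y\<close>, the converse \<open>r y x\<close> says that the heads are
  equivalent; so the two alternatives of the definition merge into one recursive clause.\<close>

lemma lex_le_Cons_Cons [simp]:
  "lex_le r (x # xs) (y # ys) \<longleftrightarrow> r x y \<and> (r y x \<longrightarrow> lex_le r xs ys)"
proof -
  have "(\<exists>s < min (length (x # xs)) (length (y # ys)).
        (\<forall>i < s. eqv r ((x # xs) ! i) ((y # ys) ! i)) \<and> strict r ((x # xs) ! s) ((y # ys) ! s))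
     \<longleftrightarrow> strict r x y \<or> (eqv r x y \<and> (\<exists>s < min (length xs) (length ys).
        (\<forall>i < s. eqv r (xs ! i) (ys ! i)) \<and> strict r (xs ! s) (ys ! s)))" (is "?A \<longleftrightarrow> ?B")
  proof
    assume ?A
    then obtain s where s: "s < min (length (x # xs)) (length (y # ys))"
      "\<forall>i < s. eqv r ((x # xs) ! i) ((y # ys) ! i)" "strict r ((x # xs) ! s) ((y # ys) ! s)" by blast
    show ?B
    proof (cases s)
      case 0 then show ?thesis using s by simp
    next
      case (Suc t)
      have "eqv r x y" using s(2) Suc by fastforce
      moreover have "\<forall>i<t. eqv r (xs ! i) (ys ! i)" using s(2) Suc by fastforce
      ultimately show ?thesis using s Suc by auto
    qed
  next
    assume ?B
    then show ?A
    proof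
      assume "strict r x y" then show ?A by (intro exI[of _ 0]) auto
    next
      assume "eqv r x y \<and> (\<exists>s < min (length xs) (length ys).
        (\<forall>i < s. eqv r (xs ! i) (ys ! i)) \<and> strict r (xs ! s) (ys ! s))"
      then obtain s where "eqv r x y" "s < min (length xs) (length ys)"
        "\<forall>i < s. eqv r (xs ! i) (ys ! i)" "strict r (xs ! s) (ys ! s)" by blast
      then show ?A by (intro exI[of _ "Suc s"]) (auto simp: nth_Cons split: nat.splits)
    qed
  qed
  moreover have "(length (x # xs) \<le> length (y # ys) \<and> (\<forall>i < length (x # xs). eqv r ((x # xs) ! i) ((y # ys) ! i)))
    \<longleftrightarrow> eqv r x y \<and> length xs \<le> length ys \<and> (\<forall>i < length xs. eqv r (xs ! i) (ys ! i))"
    by (auto simp: nth_Cons split: nat.splits)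
  ultimately show ?thesis
    unfolding lex_le_def by (auto simp: eqv_def strict_def)
qed

lemma lex_le_total:
  assumes "total_preorder r" shows "lex_le r xs ys \<or> lex_le r ys xs"
proof (induction xs arbitrary: ys)
  case (Cons x xs)
  then show ?case using total_preorder_total[OF assms] by (cases ys) auto
qed simp

lemma lex_le_trans:
  assumes r: "total_preorder r" shows "lex_le r xs ys \<Longrightarrow> lex_le r ys zs \<Longrightarrow> lex_le r xs zs"
proof (induction xs arbitrary: ys zs)
  case (Cons x xs)
  then obtain y ys' where y: "ys = y # ys'" by (cases ys) auto
  then obtain z zs' where z: "zs = z # zs'" using Cons by (cases zs) auto
  show ?case using Cons total_preorder_trans[OF r] unfolding y z by (simp; blast)
qed simp

lemma lex_le_preorder: "total_preorder r \<Longrightarrow> total_preorder (lex_le r)"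
  unfolding total_preorder_def[of "lex_le r"]
  using lex_le_total lex_le_trans by (metis transpI)

lemma lex_le_cong:
  "(\<And>a b. a \<in> set xs \<Longrightarrow> b \<in> set ys \<Longrightarrow> r a b = r' a b \<and> r b a = r' b a)
   \<Longrightarrow> lex_le r xs ys = lex_le r' xs ys"
proof (induction xs arbitrary: ys)
  case (Cons x xs)
  show ?case
  proof (cases ys)
    case (Cons y ys')
    have "lex_le r xs ys' = lex_le r' xs ys'" using Cons.IH Cons.prems Cons by simp
    moreover have "r x y = r' x y \<and> r y x = r' y x" using Cons.prems Cons by simp
    ultimately show ?thesis using Cons by simp
  qed simp
qed simp

lemma lex_le_append:
  "total_preorder r \<Longrightarrow> lex_le r (zs @ xs) (zs @ ys) \<longleftrightarrow> lex_le r xs ys"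
  by (induction zs) (auto simp: total_preorder_refl)

section \<open>Lexicographically maximal subsequences\<close>

definition lexmax_le :: "('a \<Rightarrow> 'a \<Rightarrow> bool) \<Rightarrow> 'a list \<Rightarrow> 'a list \<Rightarrow> bool" where
  "lexmax_le r L M = lex_le r (SOME C. lexmax r L C) (SOME D. lexmax r M D)"

lemma finite_total_preorder_max:
  assumes "total_preorder r" "finite S" "S \<noteq> {}"
  shows "\<exists>m\<in>S. \<forall>x\<in>S. r x m"
  using assms(2,3)
proof (induction S rule: finite_ne_induct)
  case (singleton x) then show ?case using total_preorder_refl[OF assms(1)] by simp
next
  case (insert x F)
  then obtain m where "m \<in> F" "\<forall>x\<in>F. r x m" by blast
  then show ?case using total_preorder_total[OF assms(1), of x m] total_preorder_trans[OF assms(1)]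
      total_preorder_refl[OF assms(1)] by (metis insert_iff)
qed

lemma lexmax_iff:
  assumes "total_preorder r"
  shows "lexmax r L C \<longleftrightarrow> subseq C L \<and> (\<forall>D. subseq D L \<longrightarrow> lex_le r D C)"
  unfolding lexmax_def lex_less_def in_set_subseqs Ball_def using lex_le_total[OF assms] by blast

lemma lexmax_some:
  assumes "total_preorder r"
  shows "lexmax r L (SOME C. lexmax r L C)"
proof -
  have "finite (set (subseqs L))" "set (subseqs L) \<noteq> {}"
    using subseqs_refl by (simp, metis empty_iff)
  then have "\<exists>C. lexmax r L C"
    using finite_total_preorder_max[OF lex_le_preorder[OF assms]]
    unfolding lexmax_iff[OF assms] by (metis in_set_subseqs)
  then show ?thesis by (rule someI_ex)
qed

text \<open>A maximal subsequence dominates all others, so comparing two of them is a cofinality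
  statement, independent of which of several equivalent maxima is chosen.\<close>

lemma lexmax_le_iff:
  assumes "total_preorder r"
  shows "lexmax_le r L M \<longleftrightarrow> (\<forall>C. subseq C L \<longrightarrow> (\<exists>D. subseq D M \<and> lex_le r C D))"
  using lexmax_some[OF assms, of L] lexmax_some[OF assms, of M]
  unfolding lexmax_le_def lexmax_iff[OF assms]
  using lex_le_trans[OF assms] by meson

lemma lexmax_le_preorder:
  assumes "total_preorder r" shows "total_preorder (\<lambda>A B. lexmax_le r (f A) (f B))"
  unfolding total_preorder_def lexmax_le_def
  using lex_le_total[OF assms] lex_le_trans[OF assms] by (auto intro!: transpI; blast)

lemma subseq_set: "subseq xs ys \<Longrightarrow> set xs \<subseteq> set ys"
  by (metis notin_set_nthsI subseq_conv_nths subsetI)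

lemma lexmax_cong:
  assumes "\<And>a b. a \<in> set L \<Longrightarrow> b \<in> set L \<Longrightarrow> r a b = r' a b"
  shows "lexmax r L = lexmax r' L"
proof
  fix C
  show "lexmax r L C = lexmax r' L C"
  proof (cases "subseq C L")
    case True
    have "lex_less r C D = lex_less r' C D" if "subseq D L" for D
      unfolding lex_less_def
      using lex_le_cong[of C D r r'] lex_le_cong[of D C r r'] assms subseq_set[OF True] subseq_set[OF that]
      by (simp add: subset_iff)
    then show ?thesis by (auto simp: lexmax_def)
  qed (simp add: lexmax_def)
qed

lemma lexmax_le_cong:
  assumes "total_preorder r'"
  assumes "\<And>a b. a \<in> set L \<union> set M \<Longrightarrow> b \<in> set L \<union> set M \<Longrightarrow> r a b = r' a b"
  shows "lexmax_le r L M = lexmax_le r' L M"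
proof -
  have e: "lexmax r L = lexmax r' L" "lexmax r M = lexmax r' M"
    by (rule lexmax_cong; use assms in simp)+
  have "subseq (SOME C. lexmax r' L C) L" "subseq (SOME C. lexmax r' M C) M"
    using lexmax_some[OF assms(1)] lexmax_iff[OF assms(1)] by blast+
  then have "set (SOME C. lexmax r' L C) \<subseteq> set L" "set (SOME C. lexmax r' M C) \<subseteq> set M"
    by (simp_all add: subseq_set)
  then show ?thesis unfolding lexmax_le_def e
    by (intro lex_le_cong) (use assms(2) in blast)
qed

lemma subseq_singleton_right: "subseq C [X] \<longleftrightarrow> C = [] \<or> C = [X]"
  by (cases C) (auto simp: subseq_singleton_left split: if_splits)

text \<open>Cutting at a symbol that is absent from both words gives one-element lists, so such a
  cut leaves the comparison unchanged.\<close>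

lemma lexmax_le_singletons:
  assumes "total_preorder r" shows "lexmax_le r [A] [B] \<longleftrightarrow> r A B"
proof -
  have "(\<exists>D. (D = [] \<or> D = [B]) \<and> lex_le r [] D) = True" by auto
  moreover have "(\<exists>D. (D = [] \<or> D = [B]) \<and> lex_le r [A] D) = r A B"
    by (simp add: conj_disj_distribR ex_disj_distrib)
  ultimately show ?thesis unfolding lexmax_le_iff[OF assms] subseq_singleton_right
    by (metis (no_types, lifting))
qed

section \<open>Cutting words into blocks and joining them\<close>

fun joinn :: "nat \<Rightarrow> word list \<Rightarrow> word" where
  "joinn n [] = []"
| "joinn n [b] = b"
| "joinn n (b # c # bs) = b @ n # joinn n (c # bs)"

lemma splitn_ne [simp]: "splitn n w \<noteq> []"
  by (induction w) (auto simp: Let_def)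

lemma joinn_Cons: "joinn n (b # bs) = (if bs = [] then b else b @ n # joinn n bs)"
  by (cases bs) auto

lemma joinn_splitn [simp]: "joinn n (splitn n w) = w"
proof (induction w)
  case (Cons a w)
  show ?case
  proof (cases "a = n")
    case True then show ?thesis using Cons by (simp add: joinn_Cons)
  next
    case False
    obtain h t where "splitn n w = h # t" by (cases "splitn n w") auto
    then show ?thesis using Cons False by (auto simp: Let_def joinn_Cons split: if_splits)
  qed
qed simp

lemma splitn_notin [simp]: "n \<notin> set u \<Longrightarrow> splitn n u = [u]"
  by (induction u) (auto simp: Let_def)

lemma splitn_append: "n \<notin> set u \<Longrightarrow> splitn n (u @ n # v) = u # splitn n v"
  by (induction u) (auto simp: Let_def)

lemma splitn_joinn: "bs \<noteq> [] \<Longrightarrow> \<forall>b\<in>set bs. n \<notin> set b \<Longrightarrow> splitn n (joinn n bs) = bs"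
  by (induction n bs rule: joinn.induct) (auto simp: splitn_append)

lemma splitn_blocks: "b \<in> set (splitn n w) \<Longrightarrow> set b \<subseteq> set w - {n}"
proof (induction w arbitrary: b)
  case (Cons a w)
  show ?case
  proof (cases "a = n")
    case True then show ?thesis using Cons by auto
  next
    case False
    obtain h t where h: "splitn n w = h # t" by (cases "splitn n w") auto
    have "set h \<subseteq> set w - {n}" "\<And>c. c \<in> set t \<Longrightarrow> set c \<subseteq> set w - {n}" using Cons.IH h by auto
    then show ?thesis using Cons.prems False h by (auto simp: Let_def)
  qed
qed auto

lemma splitn_block_length: "b \<in> set (splitn n w) \<Longrightarrow> length b \<le> length w"
proof (induction w arbitrary: b)
  case (Cons a w)
  show ?case
  proof (cases "a = n")
    case True then show ?thesis using Cons by (auto simp: le_SucI)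
  next
    case False
    obtain h t where h: "splitn n w = h # t" by (cases "splitn n w") auto
    then show ?thesis using Cons.prems Cons.IH[of b] Cons.IH[of h] False by (auto simp: Let_def)
  qed
qed auto

lemma splitn_block_length_less: "n \<in> set w \<Longrightarrow> b \<in> set (splitn n w) \<Longrightarrow> length b < length w"
proof (induction w arbitrary: b)
  case (Cons a w)
  show ?case
  proof (cases "a = n")
    case True then show ?thesis using Cons.prems splitn_block_length[of b n w]
      by (auto simp: less_Suc_eq_le)
  next
    case False
    obtain h t where h: "splitn n w = h # t" by (cases "splitn n w") auto
    then show ?thesis using Cons.prems Cons.IH[of b] Cons.IH[of h] False
      by (auto simp: Let_def)
  qed
qed auto

lemma length_splitn: "length (splitn n w) = Suc (count_list w n)"
proof (induction w)
  case (Cons a w)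
  then show ?case by (cases "splitn n w") (auto simp: Let_def)
qed simp

lemma set_joinn: "set (joinn n bs) \<subseteq> insert n (\<Union>(set ` set bs))"
  by (induction n bs rule: joinn.induct) auto

lemma splitn_append_right:
  "splitn n (A @ v) = butlast (splitn n A) @ splitn n (last (splitn n A) @ v)"
proof (induction A)
  case (Cons a A)
  show ?case
  proof (cases "a = n")
    case True then show ?thesis using Cons by auto
  next
    case False
    obtain h t where h: "splitn n A = h # t" by (cases "splitn n A") auto
    show ?thesis
    proof (cases t)
      case Nil
      then have "A = h" by (metis h joinn.simps(2) joinn_splitn)
      then show ?thesis using Cons False h Nil by (auto simp: Let_def)
    next
      case (Cons c d) then show ?thesis using \<open>splitn n (A @ v) = _\<close> False h by (auto simp: Let_def)
    qed
  qed
qed simp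

text \<open>\<open>pre\<close> cuts at the least symbol of the pair at hand, so three words may be
  compared with different cuts and transitivity is not visible. Here all words are cut at the same
  symbol n, and h counts the symbols from n upwards that may still occur.\<close>

primrec ble :: "nat \<Rightarrow> nat \<Rightarrow> word \<Rightarrow> word \<Rightarrow> bool" where
  "ble 0 n = (\<lambda>_ _. True)"
| "ble (Suc h) n = (\<lambda>A B. lexmax_le (ble h (Suc n)) (splitn n A) (splitn n B))"

lemma ble_preorder: "total_preorder (ble h n)"
proof (induction h arbitrary: n)
  case 0 show ?case by (simp add: total_preorder_def transp_def)
next
  case (Suc h) show ?case using lexmax_le_preorder[OF Suc] by simp
qed

lemma le_step_alt:
  "le_step r A B = (if A @ B = [] then True
     else lexmax_le r (splitn (Min (set (A @ B))) A) (splitn (Min (set (A @ B))) B))"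
  by (simp add: le_step_def lexmax_le_def Let_def)

lemma spread_mono:
  assumes "set u \<subseteq> set w - {Min (set w)}" "u \<noteq> []" shows "Suc (spread u) \<le> spread w"
proof -
  have w: "w \<noteq> []" using assms by auto
  have 1: "Max (set u) \<le> Max (set w)" using assms by (intro Max_mono) auto
  have "Min (set u) \<in> set u" using assms by simp
  then have "Min (set u) \<in> set w" "Min (set u) \<noteq> Min (set w)" using assms(1) by blast+
  then have 2: "Min (set w) < Min (set u)" using w by (metis List.finite_set Min_le nless_le)
  have "Min (set u) \<le> Max (set u)" using assms(2) by (metis List.finite_set Max_ge Min_in set_empty)
  moreover have "spread u = Max (set u) - Min (set u)" "spread w = Max (set w) - Min (set w)"
    using assms(2) w by (simp_all add: spread_def)
  ultimately show ?thesis using 1 2 by linarith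
qed

text \<open>If n occurs, it is the minimum and both recursions cut there; if not, the cut at n
  changes nothing by \<open>lexmax_le_singletons\<close>. The fuel d can run short only on two empty
  blocks, where every fuel gives \<open>True\<close>.\<close>

lemma pre_ble:
  assumes "set A \<union> set B \<subseteq> {n..<n+h}" "d \<ge> Suc (spread (A @ B)) \<or> A @ B = []"
  shows "pre d A B = ble h n A B"
  using assms
proof (induction h arbitrary: A B n d)
  case 0
  then have "A = []" "B = []" by auto
  then show ?case by (cases d) (simp_all add: le_step_alt)
next
  case (Suc h)
  have IH: "pre d' a b = ble h (Suc n) a b"
    if "set a \<subseteq> set (A@B) - {n}" "set b \<subseteq> set (A@B) - {n}"
       "d' \<ge> Suc (spread (a @ b)) \<or> a @ b = []" for a b d'
  proof (rule Suc.IH)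
    show "set a \<union> set b \<subseteq> {Suc n..<Suc n + h}"
    proof
      fix x assume "x \<in> set a \<union> set b"
      then have "x \<in> set (A@B)" "x \<noteq> n" using that by auto
      then show "x \<in> {Suc n..<Suc n + h}" using Suc.prems(1) by fastforce
    qed
  qed (rule that)
  show ?case
  proof (cases "n \<in> set A \<union> set B")
    case False
    then have "splitn n A = [A]" "splitn n B = [B]" by auto
    then have "ble (Suc h) n A B = ble h (Suc n) A B"
      by (simp add: lexmax_le_singletons ble_preorder)
    moreover have "pre d A B = ble h (Suc n) A B"
      by (rule IH) (use False Suc.prems in auto)
    ultimately show ?thesis by simp
  next
    case True
    then have ne: "A @ B \<noteq> []" by auto
    then obtain d' where d': "d = Suc d'" "d' \<ge> spread (A @ B)" using Suc.prems(2) by (cases d) auto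
    have m: "Min (set (A @ B)) = n" using True Suc.prems(1) by (intro Min_eqI) auto
    have "pre d A B = lexmax_le (pre d') (splitn n A) (splitn n B)"
      using ne unfolding d'(1) pre.simps le_step_alt m by (simp only: if_False)
    also have "\<dots> = lexmax_le (ble h (Suc n)) (splitn n A) (splitn n B)"
    proof (rule lexmax_le_cong[OF ble_preorder], rule IH)
      fix a b assume a: "a \<in> set (splitn n A) \<union> set (splitn n B)"
        and b: "b \<in> set (splitn n A) \<union> set (splitn n B)"
      show sa: "set a \<subseteq> set (A @ B) - {n}" using a splitn_blocks by fastforce
      show sb: "set b \<subseteq> set (A @ B) - {n}" using b splitn_blocks by fastforce
      show "Suc (spread (a @ b)) \<le> d' \<or> a @ b = []"
        using spread_mono[of "a @ b" "A @ B"] sa sb m d' by fastforce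
    qed
    finally show ?thesis by simp
  qed
qed

lemma wle_ble: "set A \<union> set B \<subseteq> {n..<n+h} \<Longrightarrow> wle A B = ble h n A B"
  unfolding wle_def by (rule pre_ble) auto

lemma wle_ble0: assumes "\<forall>x\<in>set A \<union> set B. x < h" shows "wle A B = ble h 0 A B"
  using assms by (intro wle_ble) auto

lemma wle_preorder: "total_preorder wle"
proof -
  have bound: "\<exists>h. \<forall>x\<in>set (A @ B @ C). x < h" for A B C :: word
    by (metis List.finite_set finite_nat_set_iff_bounded)
  have "wle A C" if "wle A B" "wle B C" for A B C
  proof -
    obtain h where h: "\<forall>x\<in>set (A @ B @ C). x < h" using bound by blast
    then have "wle A B = ble h 0 A B" "wle B C = ble h 0 B C" "wle A C = ble h 0 A C"
      by (auto intro!: wle_ble0)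
    then show ?thesis using that total_preorder_trans[OF ble_preorder] by blast
  qed
  moreover have "wle A B \<or> wle B A" for A B
  proof -
    obtain h where h: "\<forall>x\<in>set (A @ B @ []). x < h" using bound by blast
    then have "wle A B = ble h 0 A B" "wle B A = ble h 0 B A"
      by (auto intro!: wle_ble0)
    then show ?thesis using total_preorder_total[OF ble_preorder] by blast
  qed
  ultimately show ?thesis unfolding total_preorder_def by (auto intro: transpI)
qed

lemmas wle_refl [simp] = total_preorder_refl[OF wle_preorder]
lemmas wle_trans = total_preorder_trans[OF wle_preorder]
lemmas wle_total = total_preorder_total[OF wle_preorder]

lemma not_wle: "\<not> wle A B \<longleftrightarrow> wless B A"
  using wle_total wless_def by blast

text \<open>The working form of the preorder: n may be any lower bound, so words can be cut at a
  common symbol even if it is missing from some of them.\<close>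

lemma wle_split:
  assumes "set A \<union> set B \<subseteq> {n..}"
  shows "wle A B = lexmax_le wle (splitn n A) (splitn n B)"
proof -
  obtain h where h: "\<forall>x\<in>set A \<union> set B. x < h"
    by (metis List.finite_set finite_Un finite_nat_set_iff_bounded)
  then have s: "set A \<union> set B \<subseteq> {n..<n + Suc h}"
    using assms by (auto simp: subset_iff trans_less_add2 less_SucI)
  then have "wle A B = ble (Suc h) n A B" by (rule wle_ble)
  also have "\<dots> = lexmax_le (ble h (Suc n)) (splitn n A) (splitn n B)" by simp
  also have "\<dots> = lexmax_le wle (splitn n A) (splitn n B)"
  proof (rule lexmax_le_cong[OF wle_preorder])
    fix a b assume "a \<in> set (splitn n A) \<union> set (splitn n B)"
        and "b \<in> set (splitn n A) \<union> set (splitn n B)"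
    then have "set a \<subseteq> set A \<union> set B - {n}" "set b \<subseteq> set A \<union> set B - {n}"
      using splitn_blocks by fastforce+
    then have "set a \<union> set b \<subseteq> {Suc n..<Suc n + h}" using s by fastforce
    then show "ble h (Suc n) a b = wle a b" by (rule wle_ble[symmetric])
  qed
  finally show ?thesis .
qed

lemma wle_Nil: "wle [] A"
proof (induction "length A" arbitrary: A rule: less_induct)
  case less
  show ?case
  proof (cases "A = []")
    case False
    define n where "n = Min (set A)"
    have n: "n \<in> set A" using False by (simp add: n_def)
    have s: "set [] \<union> set A \<subseteq> {n..}" by (auto simp: n_def)
    obtain b bs where b: "splitn n A = b # bs" by (cases "splitn n A") auto
    have "wle [] b" using less splitn_block_length_less[OF n, of b] b by simp
    have "\<exists>D. subseq D (b # bs) \<and> lex_le wle C D" if "subseq C [[]]" for C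
    proof (cases "C = []")
      case True then show ?thesis by (intro exI[of _ "[]"]) simp
    next
      case False
      then have "C = [[]]" using that by (simp add: subseq_singleton_right)
      then show ?thesis using \<open>wle [] b\<close> by (intro exI[of _ "[b]"]) (auto simp: subseq_singleton_left)
    qed
    then show ?thesis unfolding wle_split[OF s] lexmax_le_iff[OF wle_preorder] b by simp
  qed simp
qed

text \<open>Deleting an entry moves smaller entries forward, which never increases a nonincreasing
  list. Such a list is thus its own maximal subsequence, and on normal forms the preorder becomes
  plain lexicographic comparison of blocks.\<close>

lemma sorted_lex_subseq:
  assumes "total_preorder r" "sorted_wrt (\<lambda>x y. r y x) L" "subseq C L"
  shows "lex_le r C L"
  using assms(3,2)
proof (induction rule: list_emb.induct)
  case (list_emb_Cons xs ys y)
  then have "lex_le r xs ys" by simp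
  moreover have "lex_le r ys (y # ys)" using list_emb_Cons(3)
  proof (induction ys arbitrary: y)
    case (Cons a ys)
    then show ?case by (auto)
  qed simp
  ultimately show ?case using lex_le_trans[OF assms(1)] by blast
qed (auto simp: total_preorder_refl[OF assms(1)])

lemma lexmax_le_sorted:
  assumes "total_preorder r" "sorted_wrt (\<lambda>x y. r y x) L" "sorted_wrt (\<lambda>x y. r y x) M"
  shows "lexmax_le r L M = lex_le r L M"
  unfolding lexmax_le_iff[OF assms(1)]
  using sorted_lex_subseq[OF assms(1,2)] sorted_lex_subseq[OF assms(1,3)] lex_le_trans[OF assms(1)]
  by (meson subseq_order.order_refl)

section \<open>Normal forms\<close>

abbreviation nonincr :: "word list \<Rightarrow> bool" where
  "nonincr \<equiv> sorted_wrt (\<lambda>x y. wle y x)"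

lemma nfk_cong: "length w \<le> d \<Longrightarrow> length w \<le> d' \<Longrightarrow> nfk d w = nfk d' w"
proof (induction d arbitrary: w d')
  case 0 then show ?case by (cases d') auto
next
  case (Suc d)
  show ?case
  proof (cases "w = []")
    case True then show ?thesis by (cases d') auto
  next
    case False
    then obtain e where e: "d' = Suc e" using Suc.prems by (cases d') auto
    have "nfk d b = nfk e b" if "b \<in> set (splitn (Min (set w)) w)" for b
      using splitn_block_length_less[OF _ that] Suc e False by (intro Suc.IH) auto
    then show ?thesis using e by (auto simp: Let_def)
  qed
qed

lemma NF_Nil [simp]: "NF []" by (simp add: NF_def)

text \<open>Again n is only a lower bound: if it does not occur, the sole block is w itself.\<close>

lemma NF_split:
  assumes "set w \<subseteq> {n..}"
  shows "NF w \<longleftrightarrow> nonincr (splitn n w) \<and> (\<forall>b\<in>set (splitn n w). NF b)"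
proof (cases "n \<in> set w")
  case True
  then obtain d where d: "length w = Suc d" by (cases w) auto
  have m: "Min (set w) = n" using assms True by (intro Min_eqI) auto
  have "nfk d b = NF b" if "b \<in> set (splitn n w)" for b
    using splitn_block_length_less[OF True that] d unfolding NF_def by (intro nfk_cong) auto
  moreover have "2 \<le> length (splitn n w)" using True count_list_0_iff[of w n] by (simp add: length_splitn)
  moreover have "successively (\<lambda>x y. wle y x) (splitn n w) = nonincr (splitn n w)"
    by (intro successively_conv_sorted_wrt transpI) (rule wle_trans)
  moreover have "w \<noteq> []" using True by auto
  ultimately show ?thesis unfolding NF_def[of w] d using m by (auto simp: Let_def)
qed simp

lemma NF_wle_split:
  assumes "NF A" "NF B" "set A \<union> set B \<subseteq> {n..}"
  shows "wle A B = lex_le wle (splitn n A) (splitn n B)"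
  unfolding wle_split[OF assms(3)]
  by (rule lexmax_le_sorted[OF wle_preorder]) (use assms NF_split in auto)

lemma lex_le_antisym:
  assumes "lex_le r xs ys" "lex_le r ys xs"
  shows "list_all2 (eqv r) xs ys"
  using assms
proof (induction xs arbitrary: ys)
  case Nil then show ?case by (cases ys) auto
next
  case (Cons x xs) then show ?case by (cases ys) (auto simp: eqv_def)
qed

lemma NF_antisym:
  assumes "NF A" "NF B" "wle A B" "wle B A" shows "A = B"
  using assms
proof (induction "length A + length B" arbitrary: A B rule: less_induct)
  case less
  show ?case
  proof (cases "A @ B = []")
    case False
    define n where "n = Min (set (A @ B))"
    have "n \<in> set (A @ B)" unfolding n_def using False by (intro Min_in) auto
    then have n: "n \<in> set A \<or> n \<in> set B" by simp
    have s: "set A \<subseteq> {n..}" "set B \<subseteq> {n..}" by (auto simp: n_def)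
    have l: "list_all2 (eqv wle) (splitn n A) (splitn n B)"
      using less.prems s NF_wle_split[of A B n] NF_wle_split[of B A n] by (intro lex_le_antisym) auto
    \<comment> \<open>The minimum n occurs in A or in B, and the blocks of that word are strictly
      shorter; hence the sum of both lengths as measure.\<close>
    have "a = b" if "a \<in> set (splitn n A)" "b \<in> set (splitn n B)" "eqv wle a b" for a b
    proof (rule less.hyps)
      show "length a + length b < length A + length B"
        using n splitn_block_length[OF that(1)] splitn_block_length[OF that(2)]
          splitn_block_length_less[OF _ that(1)] splitn_block_length_less[OF _ that(2)] by fastforce
    qed (use that less.prems s NF_split in \<open>auto simp: eqv_def\<close>)
    then have "splitn n A = splitn n B" using l
      by (metis (mono_tags, lifting) list.rel_eq list.rel_mono_strong)
    then show ?thesis by (metis joinn_splitn)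
  qed simp
qed

section \<open>Appending a symbol to a normal form\<close>

text \<open>For a normal form \<open>A\<close> with symbols at least \<open>m\<close>, \<open>dia k m A\<close> is the normal form
  of \<open>A @ [m + k]\<close>.\<close>

primrec dia :: "nat \<Rightarrow> nat \<Rightarrow> word \<Rightarrow> word" where
  "dia 0 m A = A @ [m]"
| "dia (Suc k) m A = (let bs = splitn m A; E = dia k (Suc m) (last bs)
     in joinn m (filter (wle E) (butlast bs) @ [E]))"

lemma last_splitn_set: "set (last (splitn m A)) \<subseteq> set A - {m}"
  by (intro splitn_blocks) simp

lemma dia_set: "set (dia k m A) \<subseteq> insert (m + k) (set A)"
proof (induction k arbitrary: m A)
  case (Suc k)
  define E where "E = dia k (Suc m) (last (splitn m A))"
  have E: "set E \<subseteq> insert (m + Suc k) (set A)"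
    using Suc[of "Suc m" "last (splitn m A)"] last_splitn_set[of m A] by (auto simp: E_def)
  have b: "set b \<subseteq> set A" if "b \<in> set (butlast (splitn m A))" for b
    using splitn_blocks[OF in_set_butlastD[OF that]] by auto
  show ?case
  proof (cases "butlast (splitn m A) = []")
    case True
    then show ?thesis using E by (simp add: E_def Let_def)
  next
    case False
    then have "m \<in> set A"
      by (metis append_butlast_last_id butlast.simps(2) splitn_notin)
    then show ?thesis using E b set_joinn[of m "filter (wle E) (butlast (splitn m A)) @ [E]"]
      by (fastforce simp: E_def Let_def)
  qed
qed auto

lemma splitn_dia:
  "splitn m (dia (Suc k) m A) =
     filter (wle (dia k (Suc m) (last (splitn m A)))) (butlast (splitn m A)) @ [dia k (Suc m) (last (splitn m A))]"
  unfolding dia.simps Let_def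
proof (rule splitn_joinn)
  have "m \<notin> set (dia k (Suc m) (last (splitn m A)))"
    using dia_set[of k "Suc m" "last (splitn m A)"] last_splitn_set[of m A] by auto
  then show "\<forall>b\<in>set (filter (wle (dia k (Suc m) (last (splitn m A)))) (butlast (splitn m A))
      @ [dia k (Suc m) (last (splitn m A))]). m \<notin> set b"
    using splitn_blocks in_set_butlastD by fastforce
qed simp

lemma splitn_snoc: "splitn m (A @ [m]) = splitn m A @ [[]]"
proof -
  have "splitn m (A @ [m]) = butlast (splitn m A) @ splitn m (last (splitn m A) @ [m])"
    by (rule splitn_append_right)
  also have "splitn m (last (splitn m A) @ [m]) = [last (splitn m A), []]"
    using splitn_append[of m "last (splitn m A)" "[]"] last_splitn_set[of m A] by auto
  finally show ?thesis by (metis append.assoc append_Cons append_Nil append_butlast_last_id splitn_ne)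
qed

lemma splitn_snoc_other:
  "n \<noteq> m \<Longrightarrow> splitn m (A @ [n]) = butlast (splitn m A) @ [last (splitn m A) @ [n]]"
  using splitn_append_right[of m A "[n]"] last_splitn_set[of m A]
    splitn_notin[of m "last (splitn m A) @ [n]"] by fastforce

text \<open>An entry below e placed before the final e loses to e in the same position, while an
  entry that is at least e is worth keeping because L is nonincreasing.\<close>

lemma filter_lexmax:
  assumes r: "total_preorder r" and "sorted_wrt (\<lambda>x y. r y x) L" "r e e'" "r e' e" "subseq C (L @ [e'])"
  shows "lex_le r C (filter (r e) L @ [e])"
  using assms(2-)
proof (induction L arbitrary: C)
  case Nil then show ?case by (auto simp: subseq_singleton_right)
next
  case (Cons a L)
  have rest: "lex_le r D (filter (r e) (a # L) @ [e])" if "subseq D (L @ [e'])" for D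
  proof -
    have *: "lex_le r D (filter (r e) L @ [e])" using Cons that by simp
    have "lex_le r (filter (r e) L @ [e]) (a # filter (r e) L @ [e])" if "r e a"
    proof (rule sorted_lex_subseq[OF r])
      show "sorted_wrt (\<lambda>x y. r y x) (a # filter (r e) L @ [e])"
        using Cons.prems(1) that by (auto simp: sorted_wrt_append sorted_wrt_filter)
    qed auto
    then show ?thesis using * lex_le_trans[OF r] by auto
  qed
  show ?case
  proof (cases C)
    case (Cons c C')
    show ?thesis
    proof (cases "c = a")
      case False
      then show ?thesis using rest Cons.prems Cons by simp
    next
      case True
      then have s: "subseq C' (L @ [e'])" using Cons.prems Cons by simp
      show ?thesis
      proof (cases "r e a")
        case t: True
        then show ?thesis using Cons True Cons.IH[OF _ _ _ s] Cons.prems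
          by (simp add: total_preorder_refl[OF r])
      next
        case f: False
        have "filter (r e) L = []" using Cons.prems(1) f total_preorder_trans[OF r]
          by (auto simp: filter_empty_conv)
        then show ?thesis using f Cons True total_preorder_total[OF r, of e a] by simp
      qed
    qed
  qed simp
qed

text \<open>The two lists first differ at the first dropped entry, which e exceeds, or, if none is
  dropped, at the end, where e exceeds l.\<close>

lemma lex_less_filter:
  assumes r: "total_preorder r" and "sorted_wrt (\<lambda>x y. r y x) L" "r l e" "\<not> r e l"
  shows "lex_le r (L @ [l]) (filter (r e) L @ [e]) \<and> \<not> lex_le r (filter (r e) L @ [e]) (L @ [l])"
  using assms(2-)
proof (induction L)
  case (Cons a L)
  show ?case
  proof (cases "r e a")
    case True
    then show ?thesis using Cons by (simp add: total_preorder_refl[OF r])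
  next
    case f: False
    have "filter (r e) L = []" using Cons.prems(1) f total_preorder_trans[OF r]
      by (auto simp: filter_empty_conv)
    then show ?thesis using f total_preorder_total[OF r, of e a] by simp
  qed
qed simp

lemma not_lex_le_snoc: "total_preorder r \<Longrightarrow> \<not> lex_le r (xs @ y # ys) xs"
  by (induction xs) (auto simp: total_preorder_refl)

text \<open>Appending the symbol alters only the last block, to which the induction applies since m
  + Suc k = Suc m + k; by \<open>filter_lexmax\<close> the filter then picks a maximal subsequence.
  For k = 0 an empty block is added, the least word, and no block is lost.\<close>

lemma dia_props:
  assumes "set A \<subseteq> {m..}" "NF A"
  shows "NF (dia k m A) \<and> wle (dia k m A) (A @ [m + k]) \<and> wle (A @ [m + k]) (dia k m A)
    \<and> wless A (dia k m A)"
  using assms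
proof (induction k arbitrary: m A)
  case 0
  have s: "set (A @ [m]) \<subseteq> {m..}" using 0 by simp
  have NF: "NF (A @ [m])"
    using 0 unfolding NF_split[OF s] NF_split[OF 0(1)] splitn_snoc
    by (auto simp: sorted_wrt_append wle_Nil)
  have "wless A (A @ [m])"
    unfolding not_wle[symmetric]
    using NF_wle_split[OF NF 0(2), of m] s 0 not_lex_le_snoc[OF wle_preorder]
    by (auto simp: splitn_snoc)
  then show ?case using NF by simp
next
  case (Suc k)
  define bs where "bs = splitn m A"
  define E where "E = dia k (Suc m) (last bs)"
  define D where "D = dia (Suc k) m A"
  have bs: "nonincr bs" "\<forall>b\<in>set bs. NF b" using NF_split Suc.prems unfolding bs_def by blast+
  have bs': "bs = butlast bs @ [last bs]" by (simp add: bs_def)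
  have bl: "nonincr (butlast bs)" using bs(1) bs' by (metis sorted_wrt_append)
  have b: "set b \<subseteq> {Suc m..}" if "b \<in> set bs" for b
    using splitn_blocks[OF that[unfolded bs_def]] Suc.prems(1) by fastforce
  have l: "last bs \<in> set bs" by (simp add: bs_def)
  have E: "NF E" "wle E (last bs @ [m + Suc k])" "wle (last bs @ [m + Suc k]) E" "wless (last bs) E"
    using Suc.IH[OF b[OF l]] l bs(2) by (auto simp: E_def)
  have sD: "set D \<subseteq> {m..}" using dia_set[of "Suc k" m A] Suc.prems(1) by (auto simp: D_def)
  have splD: "splitn m D = filter (wle E) (butlast bs) @ [E]"
    unfolding D_def E_def bs_def by (rule splitn_dia)
  have nD: "nonincr (filter (wle E) (butlast bs) @ [E])"
    using bl by (auto simp: sorted_wrt_append sorted_wrt_filter)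
  have NFD: "NF D"
    unfolding NF_split[OF sD] splD using nD E(1) bs(2) in_set_butlastD[of _ bs] by auto
  have splA: "splitn m (A @ [m + Suc k]) = butlast bs @ [last bs @ [m + Suc k]]"
    unfolding bs_def by (rule splitn_snoc_other) simp
  have s1: "set D \<union> set (A @ [m + Suc k]) \<subseteq> {m..}" "set (A @ [m + Suc k]) \<union> set D \<subseteq> {m..}"
    using sD Suc.prems(1) by auto
  have "wle D (A @ [m + Suc k])"
    unfolding wle_split[OF s1(1)] splD splA lexmax_le_iff[OF wle_preorder]
  proof (intro allI impI exI conjI)
    fix C assume "subseq C (filter (wle E) (butlast bs) @ [E])"
    then have "lex_le wle C (filter (wle E) (butlast bs) @ [E])"
      by (rule sorted_lex_subseq[OF wle_preorder nD])
    moreover have "lex_le wle (filter (wle E) (butlast bs) @ [E]) (filter (wle E) (butlast bs) @ [last bs @ [m + Suc k]])"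
      using E by (simp add: lex_le_append[OF wle_preorder])
    ultimately show "lex_le wle C (filter (wle E) (butlast bs) @ [last bs @ [m + Suc k]])"
      by (rule lex_le_trans[OF wle_preorder])
    show "subseq (filter (wle E) (butlast bs) @ [last bs @ [m + Suc k]]) (butlast bs @ [last bs @ [m + Suc k]])"
      by simp
  qed
  moreover have "wle (A @ [m + Suc k]) D"
    unfolding wle_split[OF s1(2)] splD splA lexmax_le_iff[OF wle_preorder]
    using filter_lexmax[OF wle_preorder bl E(2,3)] by blast
  moreover have "wless A D"
    using lex_less_filter[OF wle_preorder bl, of "last bs" E] E(4) NF_wle_split[OF NFD Suc.prems(2), of m]
      NF_wle_split[OF Suc.prems(2) NFD, of m] sD Suc.prems(1) bs'
    unfolding wless_def splD bs_def[symmetric] by auto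
  ultimately show ?case using NFD by (simp add: D_def)
qed

lemma Dia_eq: assumes "NF A" shows "Dia n A = dia n 0 A"
proof -
  note p = dia_props[of A 0 n, OF _ assms, simplified]
  show ?thesis unfolding Dia_def
  proof (rule the_equality)
    fix B assume "NF B \<and> wle B (A @ [n]) \<and> wle (A @ [n]) B"
    then show "B = dia n 0 A" using p by (meson NF_antisym wle_trans)
  qed (use p in auto)
qed

lemma NF_Dia: "NF A \<Longrightarrow> NF (Dia n A)"
  using dia_props[of A 0 n] by (simp add: Dia_eq)

lemma splitn_Dia_Suc:
  assumes "NF A"
  shows "splitn 0 (Dia (Suc k) A) =
     filter (wle (dia k 1 (last (splitn 0 A)))) (butlast (splitn 0 A)) @ [dia k 1 (last (splitn 0 A))]"
  unfolding Dia_eq[OF assms] splitn_dia One_nat_def by (rule refl)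

section \<open>Recognising initial lists of blocks\<close>

lemma lex_le_snoc_bot:
  assumes "\<And>y. r z y" "lex_le r ys xs" "\<not> lex_le r xs ys"
  shows "lex_le r (ys @ [z]) xs"
  using assms(2,3)
proof (induction ys arbitrary: xs)
  case Nil then show ?case using assms(1) by (cases xs) auto
next
  case (Cons y ys) then show ?case by (cases xs) auto
qed

text \<open>The cheapest way to exceed a list of blocks is to add the least block, the empty one. So
  \<open>A @ [m]\<close> is the immediate successor of A among the normal forms without symbols
  below m.\<close>

lemma snoc_least_above:
  assumes "NF A" "NF B" "set A \<subseteq> {m..}" "set B \<subseteq> {m..}" "wless A B"
  shows "wle (A @ [m]) B"
proof -
  have n: "NF (A @ [m])" using dia_props[OF assms(3,1), of 0] by simp
  have "lex_le wle (splitn m A) (splitn m B)" "\<not> lex_le wle (splitn m B) (splitn m A)"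
    using assms NF_wle_split[of A B m] NF_wle_split[of B A m] by (simp_all add: wless_def)
  then have "lex_le wle (splitn m A @ [[]]) (splitn m B)"
    by (intro lex_le_snoc_bot wle_Nil)
  then show ?thesis
    using assms NF_wle_split[OF n assms(2), of m] by (simp add: splitn_snoc)
qed

text \<open>No entry of xs lies strictly between l and e. If xs extends \<open>L @ [l]\<close>, then
  e beats it at l or at the first dropped entry. If xs is above \<open>L @ [l]\<close> without
  extending it, it has a larger entry b in place of some a at the first difference: if a is at least
  e, xs already exceeds the filtered list there; otherwise b exceeds l, hence is at least e, and xs
  reaches that list as well.\<close>

lemma lex_prefix_iff:
  assumes r: "total_preorder r" and "r l e" "\<not> r e l"
    and "\<And>b. b \<in> set xs \<Longrightarrow> \<not> r b l \<Longrightarrow> r e b"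
    and "sorted_wrt (\<lambda>x y. r y x) (L @ [l])" "sorted_wrt (\<lambda>x y. r y x) xs"
    and "\<And>a b. a \<in> set (L @ [l]) \<Longrightarrow> b \<in> set xs \<Longrightarrow> r a b \<Longrightarrow> r b a \<Longrightarrow> a = b"
  shows "lex_le r (L @ [l]) xs \<and> \<not> lex_le r (filter (r e) L @ [e]) xs \<longleftrightarrow> prefix (L @ [l]) xs"
  using assms(4-)
proof (induction L arbitrary: xs)
  case Nil
  show ?case
  proof (cases xs)
    case (Cons b xs')
    show ?thesis
    proof (cases "l = b")
      case True
      then show ?thesis using Cons assms(3) by (simp add: total_preorder_refl[OF r])
    next
      case False
      then show ?thesis using Cons Nil.prems(1)[of b] Nil.prems(4)[of l b] by auto
    qed
  qed simp
next
  case (Cons a L)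
  note pr = Cons.prems
  show ?case
  proof (cases xs)
    case x: (Cons b xs')
    have IH: "lex_le r (L @ [l]) xs' \<and> \<not> lex_le r (filter (r e) L @ [e]) xs' \<longleftrightarrow> prefix (L @ [l]) xs'"
    proof (rule Cons.IH)
      show "r e c" if "c \<in> set xs'" "\<not> r c l" for c using pr(1)[of c] x that by simp
      show "sorted_wrt (\<lambda>x y. r y x) (L @ [l])" "sorted_wrt (\<lambda>x y. r y x) xs'"
        using pr(2,3) x by simp_all
      show "c = d" if "c \<in> set (L @ [l])" "d \<in> set xs'" "r c d" "r d c" for c d
        using pr(4)[of c d] x that by simp
    qed
    have ab: "r a b \<Longrightarrow> r b a \<Longrightarrow> a = b" using pr(4)[of a b] x by simp
    have la: "r l a" using pr(2) by simp
    show ?thesis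
    proof (cases "r e a")
      case True
      then show ?thesis using IH x ab by (auto simp: total_preorder_refl[OF r])
    next
      case f: False
      have F: "filter (r e) L = []" using pr(2) f total_preorder_trans[OF r]
        by (auto simp: filter_empty_conv sorted_wrt_append)
      show ?thesis
      proof (cases "a = b")
        case True
        \<comment> \<open>As xs is nonincreasing, its entries after a are at most a and so below e;
          it cannot catch up with e later.\<close>
        have "\<not> lex_le r [e] xs'"
        proof (cases xs')
          case (Cons c cs)
          then have "r c a" using pr(3) x True by simp
          then show ?thesis using f Cons total_preorder_trans[OF r] by auto
        qed simp
        then show ?thesis using IH F f x True by (auto simp: total_preorder_refl[OF r])
      next
        case False
        have "\<not> r b l" if "r a b" "\<not> r b a" using that la total_preorder_trans[OF r] by blast
        then have "r a b \<Longrightarrow> r e b" using pr(1)[of b] x ab False by auto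
        then show ?thesis using F f x False by auto
      qed
    qed
  qed simp
qed

text \<open>Blocks contain no 0, so 1 is the least symbol they can have, and by
  \<open>snoc_least_above\<close> the last block of \<open>Dia 1 z\<close> is the immediate
  successor of that of z. This is the gap between l and e that \<open>lex_prefix_iff\<close> asks
  for.\<close>

lemma prefix_iff:
  assumes "NF z" "NF x"
  shows "wle z x \<and> wless x (Dia 1 z) \<longleftrightarrow> prefix (splitn 0 z) (splitn 0 x)"
proof -
  define bs where "bs = splitn 0 z"
  define xs where "xs = splitn 0 x"
  define e where "e = last bs @ [1]"
  have bs: "nonincr bs" "\<forall>b\<in>set bs. NF b" "nonincr xs" "\<forall>b\<in>set xs. NF b"
    using assms NF_split[of z 0] NF_split[of x 0] by (auto simp: bs_def xs_def)
  have bs': "butlast bs @ [last bs] = bs" "last bs \<in> set bs" by (simp_all add: bs_def)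
  have s: "set b \<subseteq> {1..}" if "b \<in> set bs \<or> b \<in> set xs" for b
    using that splitn_blocks[of b 0] by (auto simp: bs_def xs_def Suc_le_eq subset_iff)
  have e: "NF e" "wless (last bs) e"
    using dia_props[of "last bs" 1 0] s bs' bs by (auto simp: e_def)
  have D: "splitn 0 (Dia 1 z) = filter (wle e) (butlast bs) @ [e]"
    using splitn_Dia_Suc[OF assms(1), of 0] by (simp add: e_def bs_def)
  have main: "lex_le wle (butlast bs @ [last bs]) xs \<and> \<not> lex_le wle (filter (wle e) (butlast bs) @ [e]) xs
    \<longleftrightarrow> prefix (butlast bs @ [last bs]) xs"
  proof (rule lex_prefix_iff[OF wle_preorder])
    show "wle (last bs) e" "\<not> wle e (last bs)" using e by (auto simp: wless_def)
    show "wle e b" if "b \<in> set xs" "\<not> wle b (last bs)" for b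
      unfolding e_def by (rule snoc_least_above) (use that s bs bs' in \<open>auto simp: not_wle\<close>)
    show "a = b" if "a \<in> set (butlast bs @ [last bs])" "b \<in> set xs" "wle a b" "wle b a" for a b
      using that bs bs' by (intro NF_antisym) auto
  qed (use bs bs' in auto)
  have "wle z x = lex_le wle bs xs" "wle (Dia 1 z) x = lex_le wle (filter (wle e) (butlast bs) @ [e]) xs"
    using NF_wle_split[OF assms, of 0] NF_wle_split[OF NF_Dia[OF assms(1), of 1] assms(2), of 0] D
    by (auto simp: bs_def xs_def)
  then show ?thesis using main bs' by (simp add: not_wle[symmetric] bs_def[symmetric] xs_def[symmetric])
qed

section \<open>Finite acyclic graphs encoded in words\<close>

definition pref :: "word \<Rightarrow> word \<Rightarrow> bool" where
  "pref x z \<longleftrightarrow> wle z x \<and> wless x (Dia 1 z)"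

text \<open>The equation \<open>Dia 3 w = z\<close> would be too strong. If the new last block E of
  \<open>Dia 3 w\<close> already occurs earlier in w, that occurrence survives and E stands there
  twice, whereas z may contain it once. Applying \<open>Dia 1\<close> to both sides replaces the
  last E by E1 and drops the remaining copies of E.\<close>

definition points :: "word \<Rightarrow> word \<Rightarrow> bool" where
  "points w z \<longleftrightarrow> Dia 1 (Dia 3 w) = Dia 1 z"

definition vertex :: "enat \<Rightarrow> word \<Rightarrow> word \<Rightarrow> bool" where
  "vertex \<alpha> x z \<longleftrightarrow> z \<in> WN \<alpha> \<and> pref x z \<and> (\<exists>w\<in>WN \<alpha>. pref x w \<and> points w z)"

text \<open>The condition in the middle makes u the least vertex above w. Its comparison of v' with
  w is not strict, so w itself is not a vertex either.\<close>

definition edge :: "enat \<Rightarrow> word \<Rightarrow> word \<Rightarrow> word \<Rightarrow> bool" where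
  "edge \<alpha> x u v \<longleftrightarrow> (\<exists>w\<in>WN \<alpha>. pref x w \<and> wless w u \<and>
     \<not> (\<exists>v'\<in>WN \<alpha>. vertex \<alpha> x v' \<and> wless v' u \<and> \<not> wless v' w) \<and> points w v)"

lemma wless_trans: "wless a b \<Longrightarrow> wless b c \<Longrightarrow> wless a c"
  unfolding wless_def using wle_trans by blast

lemma wless_irrefl [simp]: "\<not> wless a a" by (simp add: wless_def)

lemma wless_imp_wle: "wless a b \<Longrightarrow> wle a b" by (simp add: wless_def)

lemma wless_asym: "wless a b \<Longrightarrow> \<not> wless b a" by (simp add: wless_def)

lemma wle_wless_trans: "wle a b \<Longrightarrow> wless b c \<Longrightarrow> wless a c"
  unfolding wless_def using wle_trans by blast

lemma NF_linear: "NF a \<Longrightarrow> NF b \<Longrightarrow> wless a b \<or> a = b \<or> wless b a"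
  using NF_antisym wle_total by (auto simp: wless_def)

lemma finite_vertex: assumes "x \<in> WN \<alpha>" shows "finite {z. vertex \<alpha> x z}"
proof (rule finite_subset)
  show "{z. vertex \<alpha> x z} \<subseteq> joinn 0 ` {ps. prefix ps (splitn 0 x)}"
  proof
    fix z assume "z \<in> {z. vertex \<alpha> x z}"
    then have "prefix (splitn 0 z) (splitn 0 x)"
      using assms prefix_iff[of z x] by (auto simp: vertex_def pref_def WN_def)
    then show "z \<in> joinn 0 ` {ps. prefix ps (splitn 0 x)}"
      by (metis (mono_tags) imageI joinn_splitn mem_Collect_eq)
  qed
  have "{ps. prefix ps (splitn 0 x)} = set (prefixes (splitn 0 x))" by auto
  then show "finite (joinn 0 ` {ps. prefix ps (splitn 0 x)})" by (metis List.finite_set finite_imageI)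
qed

text \<open>For strictly decreasing xs this is the initial segment that ends with the block a.
  Blocks thus name initial segments, and a larger block names a smaller segment.\<close>

definition initial :: "word list \<Rightarrow> word \<Rightarrow> word" where
  "initial xs a = joinn 0 (filter (wle a) xs)"

definition decr_blocks :: "word list \<Rightarrow> bool" where
  "decr_blocks xs \<longleftrightarrow> xs \<noteq> [] \<and> sorted_wrt (\<lambda>x y. wless y x) xs \<and> (\<forall>a\<in>set xs. NF a \<and> 0 \<notin> set a)"

lemma decr_nonincr: "sorted_wrt (\<lambda>x y. wless y x) xs \<Longrightarrow> nonincr xs"
  by (rule sorted_wrt_mono_rel) (auto intro: wless_imp_wle)

lemma NF_joinn:
  assumes "bs \<noteq> []" "nonincr bs" "\<forall>b\<in>set bs. NF b \<and> set b \<subseteq> {Suc n..}"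
  shows "NF (joinn n bs)" "splitn n (joinn n bs) = bs"
proof -
  have *: "\<forall>b\<in>set bs. n \<notin> set b" using assms(3) by fastforce
  show s: "splitn n (joinn n bs) = bs" using assms(1) * by (intro splitn_joinn)
  have "set (joinn n bs) \<subseteq> {n..}" using set_joinn[of n bs] assms(3) by fastforce
  then show "NF (joinn n bs)" using assms NF_split s by simp
qed

lemma symbols_ge_1: "0 \<notin> set a \<longleftrightarrow> set a \<subseteq> {1..}" for a :: word
proof -
  have e: "{1..} = - {0::nat}" by force
  show ?thesis unfolding e by blast
qed

lemma NF_joinn0:
  assumes "bs \<noteq> []" "nonincr bs" "\<forall>b\<in>set bs. NF b \<and> 0 \<notin> set b"
  shows "NF (joinn 0 bs)" "splitn 0 (joinn 0 bs) = bs"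
  using assms NF_joinn[of bs 0] by (simp_all add: symbols_ge_1)

lemma decr_blocks_split:
  assumes "decr_blocks xs" "a \<in> set xs"
  obtains us vs where "xs = us @ a # vs" "\<forall>u\<in>set us. wless a u" "\<forall>v\<in>set vs. wless v a"
proof -
  obtain us vs where "xs = us @ a # vs" using assms(2) by (meson split_list)
  then show thesis using assms(1) that[of us vs] by (auto simp: decr_blocks_def sorted_wrt_append)
qed

lemma filter_split:
  assumes "\<forall>u\<in>set us. wless a u" "\<forall>v\<in>set vs. wless v a"
  shows "filter (wle a) (us @ a # vs) = us @ [a]"
proof -
  have "filter (wle a) us = us" using assms(1) by (simp add: wless_def)
  moreover have "filter (wle a) vs = []" using assms(2) by (auto simp: wless_def filter_empty_conv)
  ultimately show ?thesis by simp
qed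

lemma NF_initial:
  assumes "decr_blocks xs" "a \<in> set xs"
  shows "NF (initial xs a)" "splitn 0 (initial xs a) = filter (wle a) xs" "set (initial xs a) \<subseteq> insert 0 (\<Union>(set ` set xs))"
proof -
  have "filter (wle a) xs \<noteq> []" using assms(2) wle_refl[of a] unfolding filter_empty_conv by blast
  then show "NF (initial xs a)" "splitn 0 (initial xs a) = filter (wle a) xs"
    unfolding initial_def using assms(1)
    by (auto intro!: NF_joinn0 dest!: decr_nonincr simp: decr_blocks_def sorted_wrt_filter)
  show "set (initial xs a) \<subseteq> insert 0 (\<Union>(set ` set xs))"
    unfolding initial_def using set_joinn[of 0 "filter (wle a) xs"] by auto
qed

lemma filter_above:
  assumes "decr_blocks xs" "xs = us @ a # vs" "wless a e"
  shows "filter (wle e) us = filter (wle e) xs"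
proof -
  have "\<forall>v\<in>set (a # vs). \<not> wle e v"
    using assms wle_wless_trans[of e] by (auto simp: decr_blocks_def sorted_wrt_append wless_def; meson wle_trans)
  then show ?thesis using assms(2) by auto
qed

lemma block_dia:
  assumes "decr_blocks xs" "a \<in> set xs"
  shows "wless a (dia k 1 a)" "NF (dia k 1 a)"
proof -
  have "set a \<subseteq> {1..}" "NF a" using assms by (simp_all add: decr_blocks_def symbols_ge_1)
  then show "wless a (dia k 1 a)" "NF (dia k 1 a)" using dia_props by blast+
qed

lemma splitn_Dia_initial:
  assumes "decr_blocks xs" "a \<in> set xs"
  shows "splitn 0 (Dia (Suc k) (initial xs a)) = filter (wle (dia k 1 a)) xs @ [dia k 1 a]"
proof -
  obtain us vs where s: "xs = us @ a # vs" "\<forall>u\<in>set us. wless a u" "\<forall>v\<in>set vs. wless v a"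
    using decr_blocks_split[OF assms] .
  have "splitn 0 (initial xs a) = us @ [a]" using NF_initial[OF assms] filter_split[OF s(2,3)] s(1) by simp
  then show ?thesis
    using splitn_Dia_Suc[OF NF_initial(1)[OF assms], of k] filter_above[OF assms(1) s(1) block_dia(1)[OF assms, of k]]
    by simp
qed

text \<open>Inside a block the least level is 1, so appending 3 is \<open>dia 2 1\<close>. The first
  diamond keeps the blocks that are at least E, the second only those that are at least E1; the
  outcome depends on a through E alone.\<close>

lemma splitn_Dia1_Dia3_initial:
  assumes "decr_blocks xs" "a \<in> set xs"
  shows "splitn 0 (Dia 1 (Dia 3 (initial xs a))) = filter (wle (dia 2 1 a @ [1])) xs @ [dia 2 1 a @ [1]]"
proof -
  define E where "E = dia 2 1 a"
  have 3: "splitn 0 (Dia 3 (initial xs a)) = filter (wle E) xs @ [E]"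
    using splitn_Dia_initial[OF assms, of 2] by (simp add: E_def eval_nat_numeral)
  have E: "NF E" using block_dia[OF assms] by (simp add: E_def)
  have "0 \<notin> set a" using assms by (auto simp: decr_blocks_def)
  then have "set E \<subseteq> {1..}" using dia_set[of 2 1 a] unfolding symbols_ge_1[symmetric] E_def by auto
  then have l: "wless E (E @ [1])" using dia_props[of E 1 0] E by simp
  have "wle E b \<and> wle (E @ [1]) b \<longleftrightarrow> wle (E @ [1]) b" for b
    using wle_trans[of E "E @ [1]" b] wless_imp_wle[OF l] by blast
  then have f: "filter (wle (E @ [1])) (filter (wle E) xs) = filter (wle (E @ [1])) xs"
    unfolding filter_filter by (intro filter_cong) auto
  have "splitn 0 (Dia (Suc 0) (Dia 3 (initial xs a))) = filter (wle (E @ [1])) xs @ [E @ [1]]"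
    unfolding f[symmetric] using splitn_Dia_Suc[OF NF_Dia[OF NF_initial(1)[OF assms]], of 0 3] unfolding 3 by simp
  then show ?thesis by (simp add: E_def)
qed

text \<open>Both block lists have the form "everything at least t, then t", so they agree as soon as
  their last blocks, E1 and b1, agree.\<close>

lemma points_initial:
  assumes "decr_blocks xs" "a \<in> set xs" "b \<in> set xs"
  shows "points (initial xs a) (initial xs b) \<longleftrightarrow> dia 2 1 a = b"
proof
  have b: "splitn 0 (Dia 1 (initial xs b)) = filter (wle (b @ [1])) xs @ [b @ [1]]"
    using splitn_Dia_initial[OF assms(1,3), of 0] by simp
  note a = splitn_Dia1_Dia3_initial[OF assms(1,2)]
  show "dia 2 1 a = b" if "points (initial xs a) (initial xs b)"
  proof -
    have "last (filter (wle (dia 2 1 a @ [1])) xs @ [dia 2 1 a @ [1]]) = last (filter (wle (b @ [1])) xs @ [b @ [1]])"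
      using a b that by (simp add: points_def)
    then show ?thesis by simp
  qed
  show "points (initial xs a) (initial xs b)" if "dia 2 1 a = b"
    unfolding points_def using a b that by (metis joinn_splitn)
qed

lemma lex_le_prefix: "total_preorder r \<Longrightarrow> lex_le r xs (xs @ ys)"
  using lex_le_append[of r xs "[]" ys] by simp

lemma initial_antimono:
  assumes "decr_blocks xs" "a \<in> set xs" "b \<in> set xs" "wless b a"
  shows "wless (initial xs a) (initial xs b)"
proof -
  obtain us vs where s: "xs = us @ a # vs" "\<forall>u\<in>set us. wless a u" "\<forall>v\<in>set vs. wless v a"
    using decr_blocks_split[OF assms(1,2)] .
  have a: "filter (wle a) xs = us @ [a]" using filter_split[OF s(2,3)] s(1) by simp
  have "filter (wle b) us = us" using s(2) assms(4) by (auto simp: filter_id_conv intro: wless_imp_wle wless_trans)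
  moreover have "b \<in> set vs" using assms(3,4) s by (auto dest: wless_asym)
  ultimately obtain y ys where b: "filter (wle b) xs = us @ [a] @ y # ys"
    using s(1) assms(4) by (cases "filter (wle b) vs") (auto simp: filter_empty_conv wless_imp_wle)
  show ?thesis
    using NF_wle_split[OF NF_initial(1)[OF assms(1,2)] NF_initial(1)[OF assms(1,3)], of 0]
      NF_wle_split[OF NF_initial(1)[OF assms(1,3)] NF_initial(1)[OF assms(1,2)], of 0]
      lex_le_prefix[OF wle_preorder, of "us @ [a]" "y # ys"] not_lex_le_snoc[OF wle_preorder, of "us @ [a]" y ys]
    unfolding wless_def NF_initial(2)[OF assms(1,2)] NF_initial(2)[OF assms(1,3)] a b by auto
qed

lemma initial_less_iff:
  assumes "decr_blocks xs" "a \<in> set xs" "b \<in> set xs"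
  shows "wless (initial xs a) (initial xs b) \<longleftrightarrow> wless b a"
  using initial_antimono[OF assms] initial_antimono[OF assms(1,3,2)] NF_linear[of a b] assms wless_asym
  by (auto simp: decr_blocks_def)

lemma pref_initial:
  assumes "decr_blocks xs" "NF z"
  shows "pref (joinn 0 xs) z \<longleftrightarrow> (\<exists>a\<in>set xs. z = initial xs a)"
proof -
  have x: "NF (joinn 0 xs)" "splitn 0 (joinn 0 xs) = xs"
    using assms(1) by (auto intro!: NF_joinn0 decr_nonincr simp: decr_blocks_def)
  have "pref (joinn 0 xs) z \<longleftrightarrow> prefix (splitn 0 z) xs"
    unfolding pref_def using prefix_iff[OF assms(2) x(1)] x(2) by simp
  also have "\<dots> \<longleftrightarrow> (\<exists>a\<in>set xs. z = initial xs a)"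
  proof
    assume "prefix (splitn 0 z) xs"
    then obtain vs where vs: "xs = splitn 0 z @ vs" by (auto simp: prefix_def)
    then have s: "xs = butlast (splitn 0 z) @ last (splitn 0 z) # vs"
      by (metis append.assoc append_Cons append_Nil append_butlast_last_id splitn_ne)
    have "filter (wle (last (splitn 0 z))) xs = butlast (splitn 0 z) @ [last (splitn 0 z)]"
      using assms(1) filter_split[of "butlast (splitn 0 z)" "last (splitn 0 z)" vs] s
      by (metis (no_types, lifting) decr_blocks_def list.set_intros(1) sorted_wrt.simps(2) sorted_wrt_append)
    then have "z = initial xs (last (splitn 0 z))" unfolding initial_def by simp
    moreover have "last (splitn 0 z) \<in> set xs" using vs by simp
    ultimately show "\<exists>a\<in>set xs. z = initial xs a" by blast
  next
    assume "\<exists>a\<in>set xs. z = initial xs a"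
    then obtain a where a: "a \<in> set xs" "z = initial xs a" by blast
    obtain us vs where s: "xs = us @ a # vs" "\<forall>u\<in>set us. wless a u" "\<forall>v\<in>set vs. wless v a"
      using decr_blocks_split[OF assms(1) a(1)] .
    then show "prefix (splitn 0 z) xs"
      using NF_initial(2)[OF assms(1) a(1)] a(2) filter_split[OF s(2,3)] by simp
  qed
  finally show ?thesis .
qed

lemma finite_NF_decr:
  assumes "finite S" "\<forall>a\<in>S. NF a"
  shows "\<exists>xs. set xs = S \<and> sorted_wrt (\<lambda>x y. wless y x) xs"
  using assms
proof (induction "card S" arbitrary: S)
  case 0 then show ?case by (intro exI[of _ "[]"]) auto
next
  case (Suc n)
  then have "S \<noteq> {}" by auto
  then obtain m where m: "m \<in> S" "\<forall>x\<in>S. wle x m"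
    using finite_total_preorder_max[OF wle_preorder Suc.prems(1)] by blast
  obtain xs where xs: "set xs = S - {m}" "sorted_wrt (\<lambda>x y. wless y x) xs"
    using Suc.hyps(1)[of "S - {m}"] Suc.hyps(2)[symmetric] Suc.prems m(1) by auto
  have "wless x m" if "x \<in> S - {m}" for x
    using that m Suc.prems(2) NF_antisym by (auto simp: wless_def)
  then show ?case using xs m by (intro exI[of _ "m # xs"]) auto
qed

section \<open>The blocks for vertices and edges\<close>

abbreviation threes :: "nat \<Rightarrow> word" where "threes i \<equiv> replicate i 3"

text \<open>\<open>Pw K l\<close> is \<open>3\<^sup>K 2 3\<^sup>K\<^sup>-\<^sup>1 2 \<dots> 2 3\<^sup>l\<close>, and \<open>Cw K l\<close> is \<open>Pw K l\<close> with \<open>2 3\<^sup>l\<close> appended.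
  The block \<open>Cw K (Suc i)\<close> is the vertex \<open>i\<close>. Appending 3 to \<open>Ew K i l\<close> normalises to
  \<open>Cw K (Suc l)\<close>, so this block can be read as an edge from \<open>i\<close> to \<open>l\<close>. Appending 3 to
  \<open>Cw K i\<close> yields \<open>Cw K (Suc i)\<close>; hence \<open>Cw K 0\<close> is needed to make vertex 0 a target.\<close>

definition stair :: "nat \<Rightarrow> nat \<Rightarrow> word list" where
  "stair K l = map threes (rev [l..<Suc K])"

definition Pw :: "nat \<Rightarrow> nat \<Rightarrow> word" where
  "Pw K l = joinn 2 (stair K l)"

definition Cw :: "nat \<Rightarrow> nat \<Rightarrow> word" where
  "Cw K l = joinn 2 (stair K l @ [threes l])"

definition Ew :: "nat \<Rightarrow> nat \<Rightarrow> nat \<Rightarrow> word" where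
  "Ew K i l = joinn 1 [Cw K (Suc i), Pw K l]"

lemma splitn_threes: "splitn 3 (threes i) = replicate (Suc i) []"
  by (induction i) auto

lemma lex_le_replicate: "total_preorder r \<Longrightarrow> lex_le r (replicate a x) (replicate b x) \<longleftrightarrow> a \<le> b"
proof (induction a arbitrary: b)
  case (Suc a) then show ?case by (cases b) (auto simp: total_preorder_refl)
qed simp

lemma threes_set: "set (threes i) \<subseteq> {3..}"
  by (auto simp: set_replicate_conv_if)

lemma NF_threes: "NF (threes i)"
proof -
  have "nonincr (replicate (Suc i) [])" by (simp add: sorted_wrt_iff_nth_less del: replicate_Suc)
  then show ?thesis unfolding NF_split[OF threes_set] splitn_threes by simp
qed

lemma wle_threes: "wle (threes i) (threes j) \<longleftrightarrow> i \<le> j"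
  using NF_wle_split[OF NF_threes[of i] NF_threes[of j], of 3] threes_set[of i] threes_set[of j]
  by (simp add: splitn_threes lex_le_replicate[OF wle_preorder] del: replicate_Suc)

lemma nonincr_stair: "nonincr (stair K l @ [threes l])" "nonincr (stair K l)"
proof -
  have "sorted_wrt (\<lambda>x y. y \<le> x) (rev [l..<Suc K])" by (simp add: sorted_wrt_rev del: upt_Suc)
  then show "nonincr (stair K l)" by (simp add: stair_def sorted_wrt_map wle_threes del: upt_Suc)
  then show "nonincr (stair K l @ [threes l])"
    by (auto simp: sorted_wrt_append stair_def wle_threes)
qed

lemma stair_symbols: "b \<in> set (stair K l) \<Longrightarrow> NF b \<and> set b \<subseteq> {Suc 2..}"
  by (auto simp: stair_def NF_threes)

lemma stair_ne: "l \<le> K \<Longrightarrow> stair K l \<noteq> []" by (simp add: stair_def)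

lemma Cw: "NF (Cw K l)" "splitn 2 (Cw K l) = stair K l @ [threes l]"
  unfolding Cw_def using NF_joinn[OF _ nonincr_stair(1), of K l 2] stair_symbols[of _ K l] threes_set[of l]
  by (auto simp: NF_threes)

lemma Pw: assumes "l \<le> K" shows "NF (Pw K l)" "splitn 2 (Pw K l) = stair K l"
  unfolding Pw_def using NF_joinn[OF stair_ne[OF assms] nonincr_stair(2), of 2] stair_symbols by auto

lemma Cw_set: "set (Cw K l) \<subseteq> {2, 3}" "set (Pw K l) \<subseteq> {2, 3}"
  unfolding Cw_def Pw_def using set_joinn[of 2 "stair K l @ [threes l]"] set_joinn[of 2 "stair K l"]
  by (auto simp: stair_def split: if_splits)

lemma stair_append: "i \<le> j \<Longrightarrow> j \<le> Suc K \<Longrightarrow> stair K i = stair K j @ map threes (rev [i..<j])"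
  unfolding stair_def map_append[symmetric] rev_append[symmetric]
  using upt_add_eq_append[of i j "Suc K - j"] by simp

lemma stair_Suc: "l \<le> K \<Longrightarrow> stair K l = stair K (Suc l) @ [threes l]"
  using stair_append[of l "Suc l" K] by simp

text \<open>After the common part \<open>stair K j\<close> the larger word repeats the step of
  length j, while the smaller one goes on with the step of length j - 1.\<close>

lemma Cw_less: assumes "i < j" "j \<le> Suc K" shows "wless (Cw K i) (Cw K j)"
proof -
  obtain k where k: "j = Suc k" using assms by (cases j) auto
  have "rev [i..<j] = k # rev [i..<k]" using k assms by simp
  then have s: "stair K i @ [threes i] = stair K j @ threes k # map threes (rev [i..<k]) @ [threes i]"
    using stair_append[of i j K] assms by simp
  have "\<not> wle (Cw K j) (Cw K i)"
  proof -
    have "wle (Cw K j) (Cw K i) = lex_le wle (stair K j @ [threes j]) (stair K i @ [threes i])"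
      using NF_wle_split[OF Cw(1) Cw(1), of K j K i 2] Cw_set(1)[of K] by (fastforce simp: Cw(2))
    also have "\<dots> = False" unfolding s lex_le_append[OF wle_preorder] using k by (simp add: wle_threes del: replicate_Suc)
    finally show ?thesis by simp
  qed
  then show ?thesis by (simp add: not_wle)
qed

text \<open>The staircase down to l is a prefix of the one down to i. This inequality makes
  \<open>Ew\<close> a normal form, and it is why edges must increase the order.\<close>

lemma Pw_le_Cw: assumes "i \<le> l" "l \<le> K" shows "wle (Pw K l) (Cw K i)"
proof -
  have "wle (Pw K l) (Cw K i) = lex_le wle (stair K l) (stair K i @ [threes i])"
    using NF_wle_split[OF Pw(1) Cw(1), of l K K i 2] Cw_set[of K] assms by (fastforce simp: Cw(2) Pw(2))
  also have "\<dots> = True" using stair_append[of i l K] assms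
    by (simp add: lex_le_prefix[OF wle_preorder])
  finally show ?thesis by simp
qed

lemma Ew: assumes "i < l" "l \<le> K"
  shows "NF (Ew K i l)" "splitn 1 (Ew K i l) = [Cw K (Suc i), Pw K l]"
proof -
  have "\<forall>b\<in>set [Cw K (Suc i), Pw K l]. NF b \<and> set b \<subseteq> {Suc 1..}"
    using Cw(1) Pw(1)[OF assms(2)] Cw_set[of K] by fastforce
  moreover have "nonincr [Cw K (Suc i), Pw K l]" using Pw_le_Cw[of "Suc i" l K] assms by simp
  ultimately show "NF (Ew K i l)" "splitn 1 (Ew K i l) = [Cw K (Suc i), Pw K l]"
    unfolding Ew_def using NF_joinn[of "[Cw K (Suc i), Pw K l]" 1] by blast+
qed

lemma Ew_set: "set (Ew K i l) \<subseteq> {1, 2, 3}"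
  unfolding Ew_def using set_joinn[of 1 "[Cw K (Suc i), Pw K l]"] Cw_set[of K] by fastforce

lemma Cw_split1: "splitn 1 (Cw K l) = [Cw K l]" "splitn 1 (Pw K l) = [Pw K l]"
  using Cw_set[of K l] by (intro splitn_notin; fastforce)+

text \<open>\<open>Ew K i l\<close> extends \<open>Cw K (Suc i)\<close> by one more part after a 1.
  So it lies above this vertex block and, as the next lemma shows, still below the later
  ones.\<close>

lemma Cw_less_Ew: assumes "i < l" "l \<le> K" shows "wless (Cw K (Suc i)) (Ew K i l)"
proof -
  have "wle (Ew K i l) (Cw K (Suc i)) = lex_le wle [Cw K (Suc i), Pw K l] [Cw K (Suc i)]"
    using NF_wle_split[OF Ew(1)[OF assms] Cw(1), of K "Suc i" 1] Cw_set[of K] Ew_set[of K]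
    by (fastforce simp: Cw_split1[unfolded One_nat_def] Ew(2)[OF assms, unfolded One_nat_def])
  then show ?thesis by (simp add: not_wle[symmetric])
qed

lemma Ew_less_Cw: assumes "i < l" "l \<le> K" "Suc i < j" "j \<le> Suc K" shows "wless (Ew K i l) (Cw K j)"
proof -
  have "wle (Cw K j) (Ew K i l) = lex_le wle [Cw K j] [Cw K (Suc i), Pw K l]"
    using NF_wle_split[OF Cw(1) Ew(1)[OF assms(1,2)], of K j 1] Cw_set[of K] Ew_set[of K]
    by (fastforce simp: Cw_split1[unfolded One_nat_def] Ew(2)[OF assms(1,2), unfolded One_nat_def])
  then show ?thesis using Cw_less[OF assms(3,4)] by (simp add: not_wle[symmetric])
qed

lemma filter_stair:
  "filter (wle (threes (Suc l))) (stair K l) = stair K (Suc l)" if "l \<le> K"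
proof -
  have "filter (wle (threes (Suc l))) (stair K (Suc l)) = stair K (Suc l)"
    unfolding filter_id_conv by (auto simp: stair_def wle_threes simp del: replicate_Suc)
  then show ?thesis using stair_Suc[OF that] by (simp add: wle_threes del: replicate_Suc)
qed

lemma eq_by_splitn: "splitn n a = splitn n b \<Longrightarrow> a = b"
  by (metis joinn_splitn)

text \<open>The last step grows from l to l + 1 and all earlier steps, being at least as long,
  remain. For l < K the step l + 1 is then present twice, whence the doubled end of
  \<open>Cw\<close>.\<close>

lemma dia_Pw: assumes "l \<le> K" shows "dia 1 2 (Pw K l) = Cw K (Suc l)"
proof (rule eq_by_splitn)
  have e: "dia 0 (Suc 2) (threes l) = threes (Suc l)" by (simp add: replicate_append_same)
  have "filter (wle (threes (Suc l))) (stair K (Suc l)) = stair K (Suc l)"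
    unfolding filter_id_conv by (auto simp: stair_def wle_threes simp del: replicate_Suc)
  then show "splitn 2 (dia 1 2 (Pw K l)) = splitn 2 (Cw K (Suc l))"
    unfolding One_nat_def splitn_dia Pw(2)[OF assms] Cw(2) stair_Suc[OF assms] last_snoc butlast_snoc e by simp
qed

text \<open>One of the two last steps of length l grows; the other is now too small and is dropped.
  The result is therefore the same as for \<open>Pw\<close>.\<close>

lemma dia_Cw2: assumes "l \<le> K" shows "dia 1 2 (Cw K l) = Cw K (Suc l)"
proof (rule eq_by_splitn)
  have e: "dia 0 (Suc 2) (threes l) = threes (Suc l)" by (simp add: replicate_append_same)
  show "splitn 2 (dia 1 2 (Cw K l)) = splitn 2 (Cw K (Suc l))"
    unfolding One_nat_def splitn_dia Cw(2) last_snoc butlast_snoc e filter_stair[OF assms] by simp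
qed

lemma dia_Cw: assumes "l \<le> K" shows "dia 2 1 (Cw K l) = Cw K (Suc l)"
proof (rule eq_by_splitn)
  have e: "dia (Suc 0) (Suc 1) (Cw K l) = Cw K (Suc l)"
    using dia_Cw2[OF assms] by (simp add: numeral_2_eq_2 del: dia.simps)
  show "splitn 1 (dia 2 1 (Cw K l)) = splitn 1 (Cw K (Suc l))"
    unfolding numeral_2_eq_2 splitn_dia Cw_split1 using e by (simp del: dia.simps)
qed

text \<open>The second part grows to \<open>Cw K (Suc l)\<close>, which exceeds
  \<open>Cw K (Suc i)\<close>, so the first part is dropped and the source of the edge is
  forgotten.\<close>

lemma dia_Ew: assumes "i < l" "l < K" shows "dia 2 1 (Ew K i l) = Cw K (Suc l)"
proof (rule eq_by_splitn)
  have lK: "l \<le> K" using assms by simp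
  have e: "dia (Suc 0) (Suc 1) (Pw K l) = Cw K (Suc l)"
    using dia_Pw[OF lK] by (simp add: numeral_2_eq_2 del: dia.simps)
  have "\<not> wle (Cw K (Suc l)) (Cw K (Suc i))" using Cw_less[of "Suc i" "Suc l" K] assms by (simp add: wless_def)
  then show "splitn 1 (dia 2 1 (Ew K i l)) = splitn 1 (Cw K (Suc l))"
    unfolding numeral_2_eq_2 splitn_dia Cw_split1 Ew(2)[OF assms(1) lK] using e by (simp del: dia.simps)
qed

lemma gadget:
  fixes \<alpha> :: enat and R :: "nat \<Rightarrow> nat \<Rightarrow> bool"
  assumes "3 \<le> \<alpha>" and R: "\<And>i l. R i l \<Longrightarrow> i < l"
  shows "\<exists>x\<in>WN \<alpha>. \<exists>h. {z. vertex \<alpha> x z} = h ` {..<K} \<and>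
     (\<forall>i<K. \<forall>j<K. (wless (h j) (h i) \<longleftrightarrow> i < j) \<and> (edge \<alpha> x (h i) (h j) \<longleftrightarrow> R i j))"
proof -
  define S where "S = Cw K ` {..K} \<union> (\<lambda>(i, l). Ew K i l) ` {(i, l). i < l \<and> l < K \<and> R i l}"
  have "{(i, l). i < l \<and> l < K \<and> R i l} \<subseteq> {..<K} \<times> {..<K}" by auto
  then have fin: "finite S" unfolding S_def by (intro finite_UnI finite_imageI) (auto intro: finite_subset)
  have NFS: "\<forall>a\<in>S. NF a" using Cw(1) Ew(1) by (auto simp: S_def)
  obtain xs where xs: "set xs = S" "sorted_wrt (\<lambda>x y. wless y x) xs" using finite_NF_decr[OF fin NFS] by blast
  have symS: "set a \<subseteq> {1, 2, 3}" if "a \<in> S" for a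
    using that Cw_set[of K] Ew_set[of K] unfolding S_def by fastforce
  have "xs \<noteq> []" using xs(1) by (auto simp: S_def)
  then have db: "decr_blocks xs" using xs NFS symS by (fastforce simp: decr_blocks_def)
  define x where "x = joinn 0 xs"
  have three: "enat s \<le> \<alpha>" if "s \<le> 3" for s
    using assms(1) that by (metis enat_ord_simps(1) numeral_eq_enat order_trans)
  have WNI: "z \<in> WN \<alpha>" if "NF z" "set z \<subseteq> insert 0 (\<Union>(set ` set xs))" for z
  proof -
    have "s \<le> 3" if "s \<in> set z" for s using that \<open>set z \<subseteq> _\<close> symS xs(1) by fastforce
    then show ?thesis using that(1) three by (auto simp: WN_def)
  qed
  have xWN: "x \<in> WN \<alpha>" unfolding x_def
    using set_joinn NF_joinn0(1)[of xs] decr_nonincr db by (intro WNI) (auto simp: decr_blocks_def)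
  have initialWN: "initial xs a \<in> WN \<alpha>" if "a \<in> S" for a
    using NF_initial[OF db] that xs(1) by (intro WNI) auto
  have NFWN: "NF z" if "z \<in> WN \<alpha>" for z using that by (simp add: WN_def)
  have prefW: "z \<in> WN \<alpha> \<and> pref x z \<longleftrightarrow> (\<exists>a\<in>S. z = initial xs a)" for z
    using pref_initial[OF db, of z] initialWN NFWN NF_initial(1)[OF db] xs(1) unfolding x_def by blast
  have pts: "points (initial xs a) (initial xs b) \<longleftrightarrow> dia 2 1 a = b" if "a \<in> S" "b \<in> S" for a b
    using points_initial[OF db] that xs(1) by simp
  have lessc: "wless (initial xs a) (initial xs b) \<longleftrightarrow> wless b a" if "a \<in> S" "b \<in> S" for a b
    using initial_less_iff[OF db] that xs(1) by simp
  have CS: "Cw K i \<in> S" if "i \<le> K" for i using that by (simp add: S_def)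
  have ES: "Ew K i l \<in> S" if "i < l" "l < K" "R i l" for i l using that by (auto simp: S_def)
  have Scases: "(\<exists>i\<le>K. a = Cw K i) \<or> (\<exists>i l. i < l \<and> l < K \<and> R i l \<and> a = Ew K i l)" if "a \<in> S" for a
    using that by (auto simp: S_def)
  \<comment> \<open>\<open>Cw K K\<close> would point to this block. Its absence keeps the number of
    vertices at exactly K.\<close>
  have top: "Cw K (Suc K) \<notin> S"
  proof
    assume "Cw K (Suc K) \<in> S"
    then consider i where "i \<le> K" "Cw K (Suc K) = Cw K i"
      | i l where "i < l" "l < K" "Cw K (Suc K) = Ew K i l" using Scases by blast
    then show False
    proof cases
      case 1 then show ?thesis using Cw_less[of i "Suc K" K] by simp
    next
      case 2 then show ?thesis using Ew_less_Cw[of i l K "Suc K"] by simp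
    qed
  qed
  have Cinj: "Cw K i = Cw K j \<Longrightarrow> i \<le> K \<Longrightarrow> j \<le> K \<Longrightarrow> i = j" for i j
    using Cw_less[of i j K] Cw_less[of j i K] by (cases i j rule: linorder_cases) auto
  have Cless: "wless (Cw K i) (Cw K j) \<longleftrightarrow> i < j" if "i \<le> K" "j \<le> K" for i j
    using that Cw_less[of i j K] Cw_less[of j i K] wless_asym by (cases i j rule: linorder_cases) auto
  define h where "h i = initial xs (Cw K (Suc i))" for i
  have V: "vertex \<alpha> x z \<longleftrightarrow> (\<exists>i<K. z = h i)" for z
  proof
    assume v: "vertex \<alpha> x z"
    then obtain b where b: "b \<in> S" "z = initial xs b" using prefW by (auto simp: vertex_def)
    from v obtain w where "w \<in> WN \<alpha> \<and> pref x w" "points w z" unfolding vertex_def by blast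
    then obtain a where a: "a \<in> S" "points (initial xs a) z" using prefW[of w] by blast
    then have ab: "dia 2 1 a = b" using pts b by simp
    from Scases[OF a(1)] show "\<exists>i<K. z = h i"
    proof (elim disjE exE conjE)
      fix i assume i: "i \<le> K" "a = Cw K i"
      then have "b = Cw K (Suc i)" using dia_Cw ab by simp
      moreover from this have "i \<noteq> K" using top b by auto
      ultimately have "i < K" "z = h i" using i b by (auto simp: h_def)
      then show ?thesis by blast
    next
      fix i l assume "i < l" "l < K" "a = Ew K i l"
      then have "b = Cw K (Suc l)" using dia_Ew ab by simp
      then show ?thesis using \<open>l < K\<close> b by (auto simp: h_def)
    qed
  next
    assume "\<exists>i<K. z = h i"
    then obtain i where i: "i < K" "z = h i" by blast
    have "points (initial xs (Cw K i)) (initial xs (Cw K (Suc i)))"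
      using pts[OF CS CS] i dia_Cw by simp
    moreover have "z = initial xs (Cw K (Suc i))" "Cw K i \<in> S" "Cw K (Suc i) \<in> S" using i CS by (auto simp: h_def)
    ultimately show "vertex \<alpha> x z" unfolding vertex_def using prefW by blast
  qed
  have E: "edge \<alpha> x (h i) (h j) \<longleftrightarrow> R i j" if ij: "i < K" "j < K" for i j
  proof -
    have Si: "Cw K (Suc i) \<in> S" "Cw K (Suc j) \<in> S" using ij CS by auto
    have "edge \<alpha> x (h i) (h j) \<longleftrightarrow> (\<exists>a\<in>S. wless (Cw K (Suc i)) a \<and>
      \<not> (\<exists>m<K. i < m \<and> \<not> wless a (Cw K (Suc m))) \<and> dia 2 1 a = Cw K (Suc j))" (is "_ \<longleftrightarrow> (\<exists>a\<in>S. ?Q a)")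
    proof -
      define A where "A w \<longleftrightarrow> wless w (h i) \<and>
         \<not> (\<exists>v'\<in>WN \<alpha>. vertex \<alpha> x v' \<and> wless v' (h i) \<and> \<not> wless v' w) \<and> points w (h j)" for w
      have A: "A (initial xs a) \<longleftrightarrow> ?Q a" if a: "a \<in> S" for a
      proof -
        have 1: "wless (initial xs a) (h i) \<longleftrightarrow> wless (Cw K (Suc i)) a"
          unfolding h_def by (rule lessc[OF a Si(1)])
        have 2: "points (initial xs a) (h j) \<longleftrightarrow> dia 2 1 a = Cw K (Suc j)"
          unfolding h_def by (rule pts[OF a Si(2)])
        have "wless (h m) (h i) \<longleftrightarrow> i < m" "wless (h m) (initial xs a) \<longleftrightarrow> wless a (Cw K (Suc m))"
          "h m \<in> WN \<alpha>" if "m < K" for m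
          using lessc[OF CS Si(1), of "Suc m"] lessc[OF CS a, of "Suc m"] Cless that ij initialWN[OF CS]
          by (auto simp: h_def)
        then have 3: "(\<exists>v'\<in>WN \<alpha>. vertex \<alpha> x v' \<and> wless v' (h i) \<and> \<not> wless v' (initial xs a))
          \<longleftrightarrow> (\<exists>m<K. i < m \<and> \<not> wless a (Cw K (Suc m)))" unfolding V by auto
        show ?thesis unfolding A_def 1 2 3 ..
      qed
      have "edge \<alpha> x (h i) (h j) \<longleftrightarrow> (\<exists>w. (w \<in> WN \<alpha> \<and> pref x w) \<and> A w)"
        unfolding edge_def A_def by blast
      also have "\<dots> \<longleftrightarrow> (\<exists>a\<in>S. A (initial xs a))" unfolding prefW by blast
      finally show ?thesis using A by simp
    qed
    also have "\<dots> \<longleftrightarrow> R i j"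
    proof
      assume "\<exists>a\<in>S. ?Q a"
      then obtain a where a: "a \<in> S" "?Q a" by blast
      from Scases[OF a(1)] show "R i j"
      proof (elim disjE exE conjE)
        fix p assume p: "p \<le> K" "a = Cw K p"
        \<comment> \<open>Such a block is itself a later vertex, which the gap condition in
          \<open>edge\<close> forbids.\<close>
        then have "Suc i < p" using a(2) Cless[of "Suc i" p] ij by simp
        then obtain m where "p = Suc m" "i < m" "m < K" using p by (cases p) auto
        then show ?thesis using a(2) p by auto
      next
        fix p l assume p: "p < l" "l < K" "R p l" "a = Ew K p l"
        have lK: "l \<le> K" using p by simp
        \<comment> \<open>The position determines the source: for p < i the block lies below
          \<open>Cw K (Suc i)\<close>, and for i < p the vertex block \<open>Cw K (Suc p)\<close>
          comes in between.\<close>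
        have "\<not> p < i" using a(2) Ew_less_Cw[OF p(1) lK, of "Suc i"] ij p wless_asym by auto
        moreover have "\<not> i < p"
          using a(2) Cw_less_Ew[OF p(1) lK] p wless_asym[of "Cw K (Suc p)"] by auto
        moreover have "Cw K (Suc l) = Cw K (Suc j)" using a(2) dia_Ew[OF p(1,2)] unfolding p(4) by metis
        then have "l = j" using Cinj[of "Suc l" "Suc j"] ij p(2) by simp
        ultimately show ?thesis using p by simp
      qed
    next
      assume r: "R i j"
      have 1: "i < j" using R[OF r] .
      have 2: "j \<le> K" using ij by simp
      have "wless (Ew K i j) (Cw K (Suc m))" if "m < K" "i < m" for m
        using Ew_less_Cw[OF 1 2, of "Suc m"] that by simp
      then have "?Q (Ew K i j)" using Cw_less_Ew[OF 1 2] dia_Ew[OF 1 ij(2)] by blast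
      then show "\<exists>a\<in>S. ?Q a" using ES[OF 1 ij(2) r] by blast
    qed
    finally show ?thesis .
  qed
  have L: "wless (h j) (h i) \<longleftrightarrow> i < j" if "i < K" "j < K" for i j
    using lessc[OF CS CS, of "Suc j" "Suc i"] Cless[of "Suc i" "Suc j"] that by (simp add: h_def)
  show ?thesis using xWN V E L by (intro bexI[of _ x] exI[of _ h]) auto
qed

section \<open>Interpreting finite bit structures\<close>

datatype af = ALt nat nat | AMem nat nat | ANeg af | AAnd af af | AEx nat af

primrec fo :: "'a set \<Rightarrow> ('a \<Rightarrow> 'a \<Rightarrow> bool) \<Rightarrow> ('a \<Rightarrow> 'a \<Rightarrow> bool) \<Rightarrow> (nat \<Rightarrow> 'a) \<Rightarrow> af \<Rightarrow> bool" where
  "fo V lt R e (ALt u v) = lt (e u) (e v)"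
| "fo V lt R e (AMem u v) = R (e u) (e v)"
| "fo V lt R e (ANeg \<phi>) = (\<not> fo V lt R e \<phi>)"
| "fo V lt R e (AAnd \<phi> \<psi>) = (fo V lt R e \<phi> \<and> fo V lt R e \<psi>)"
| "fo V lt R e (AEx x \<phi>) = (\<exists>v\<in>V. fo V lt R (e(x := v)) \<phi>)"

primrec afv :: "af \<Rightarrow> nat set" where
  "afv (ALt u v) = {u, v}"
| "afv (AMem u v) = {u, v}"
| "afv (ANeg \<phi>) = afv \<phi>"
| "afv (AAnd \<phi> \<psi>) = afv \<phi> \<union> afv \<psi>"
| "afv (AEx x \<phi>) = afv \<phi> - {x}"

lemma fo_cong: "(\<And>v. v \<in> afv \<phi> \<Longrightarrow> e v = e' v) \<Longrightarrow> fo V lt R e \<phi> = fo V lt R e' \<phi>"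
proof (induction \<phi> arbitrary: e e')
  case (AEx x \<phi>)
  have "fo V lt R (e(x := v)) \<phi> = fo V lt R (e'(x := v)) \<phi>" for v
    by (rule AEx.IH) (use AEx.prems in auto)
  then show ?case by simp
next
  case (AAnd \<phi> \<psi>)
  have "fo V lt R e \<phi> = fo V lt R e' \<phi>" "fo V lt R e \<psi> = fo V lt R e' \<psi>"
    using AAnd by (metis UnCI afv.simps(4))+
  then show ?case by simp
next
  case (ANeg \<phi>)
  have "fo V lt R e \<phi> = fo V lt R e' \<phi>" by (rule ANeg.IH) (use ANeg.prems in simp)
  then show ?case by simp
qed auto

text \<open>Formulas have no equality symbol, so a surjection that preserves both relations
  suffices.\<close>

lemma fo_iso:
  assumes "h ` V = W"
    and "\<And>u v. u \<in> V \<Longrightarrow> v \<in> V \<Longrightarrow> lt u v = lt' (h u) (h v)"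
    and "\<And>u v. u \<in> V \<Longrightarrow> v \<in> V \<Longrightarrow> R u v = R' (h u) (h v)"
    and "\<And>v. v \<in> afv \<phi> \<Longrightarrow> e v \<in> V"
  shows "fo V lt R e \<phi> = fo W lt' R' (h \<circ> e) \<phi>"
  using assms(4)
proof (induction \<phi> arbitrary: e)
  case (AEx x \<phi>)
  have "fo V lt R (e(x := v)) \<phi> = fo W lt' R' ((h \<circ> e)(x := h v)) \<phi>" if "v \<in> V" for v
    unfolding fun_upd_comp[symmetric] by (rule AEx.IH) (use that AEx.prems in auto)
  then show ?case unfolding fo.simps assms(1)[symmetric] by blast
qed (use assms(2,3) in auto)

abbreviation AEq :: "nat \<Rightarrow> nat \<Rightarrow> af" where
  "AEq u v \<equiv> AAnd (ANeg (ALt u v)) (ANeg (ALt v u))"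

abbreviation AAll :: "nat \<Rightarrow> af \<Rightarrow> af" where
  "AAll x \<phi> \<equiv> ANeg (AEx x (ANeg \<phi>))"

abbreviation AImp :: "af \<Rightarrow> af \<Rightarrow> af" where
  "AImp \<phi> \<psi> \<equiv> ANeg (AAnd \<phi> (ANeg \<psi>))"

abbreviation ASucc :: "nat \<Rightarrow> nat \<Rightarrow> nat \<Rightarrow> af" where
  "ASucc w u v \<equiv> AAnd (ALt u v) (ANeg (AEx w (AAnd (ALt u w) (ALt w v))))"

abbreviation aev :: "nat \<Rightarrow> (nat \<Rightarrow> nat) \<Rightarrow> af \<Rightarrow> bool" where
  "aev K \<equiv> fo {..<K} (<) (\<lambda>i l. i \<in> set_decode l)"

text \<open>Binary increment: the successor of \<open>u\<close> switches on the least bit missing from \<open>u\<close>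
  and switches off all lower bits. Together with the empty least element this pins down
  the bit relation on a finite linear order.\<close>

definition bit_axiom :: af where
  "bit_axiom = AAnd
    (AAll 0 (AImp (AAll 1 (ANeg (ALt 1 0))) (AAll 1 (ANeg (AMem 1 0)))))
    (AAll 0 (AAll 1 (AImp (ASucc 2 0 1)
      (AEx 2 (AAnd (ANeg (AMem 2 0)) (AAnd (AMem 2 1) (AAll 3 (AAnd
         (AImp (ALt 3 2) (AAnd (AMem 3 0) (ANeg (AMem 3 1))))
         (AImp (ALt 2 3) (AAnd (AImp (AMem 3 0) (AMem 3 1)) (AImp (AMem 3 1) (AMem 3 0))))))))))))"

lemma afv_bit_axiom: "afv bit_axiom = {}"
  by (auto simp: bit_axiom_def)

lemma fo_bit_axiom:
  "fo V lt R e bit_axiom \<longleftrightarrow>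
    (\<forall>v\<in>V. (\<forall>u\<in>V. \<not> lt u v) \<longrightarrow> (\<forall>u\<in>V. \<not> R u v)) \<and>
    (\<forall>u\<in>V. \<forall>v\<in>V. lt u v \<and> \<not> (\<exists>w\<in>V. lt u w \<and> lt w v) \<longrightarrow>
      (\<exists>i\<in>V. \<not> R i u \<and> R i v \<and> (\<forall>j\<in>V. (lt j i \<longrightarrow> R j u \<and> \<not> R j v) \<and> (lt i j \<longrightarrow> (R j u \<longleftrightarrow> R j v)))))"
  unfolding bit_axiom_def by (simp add: fun_upd_def) blast

text \<open>Each induction step removes the lowest bit: a 1 becomes 0 and the carry moves on to
  \<open>n div 2\<close>; at i = 0 the lowest bit is 0 and absorbs it.\<close>

lemma set_decode_carry:
  assumes "i \<notin> set_decode n" "\<forall>j<i. j \<in> set_decode n"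
  shows "set_decode (Suc n) = insert i (set_decode n - {..<i})"
  using assms
proof (induction i arbitrary: n)
  case 0
  then have e: "even n" by simp
  then have "Suc n div 2 = n div 2" by simp
  then have "q \<in> set_decode (Suc n) \<longleftrightarrow> q = 0 \<or> q \<in> set_decode n" for q
    using e by (cases q) auto
  then show ?case by auto
next
  case (Suc i)
  then have o: "odd n" by (metis set_decode_0 zero_less_Suc)
  then have d: "Suc n div 2 = Suc (n div 2)" by presburger
  have IH: "set_decode (Suc (n div 2)) = insert i (set_decode (n div 2) - {..<i})"
    using Suc.prems by (intro Suc.IH) (auto simp del: set_decode_Suc simp: set_decode_Suc[symmetric])
  have "q \<in> set_decode (Suc n) \<longleftrightarrow> q \<in> insert (Suc i) (set_decode n - {..<Suc i})" for q
  proof (cases q)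
    case 0 then show ?thesis using o by simp
  next
    case (Suc p)
    have "q \<in> set_decode (Suc n) \<longleftrightarrow> p \<in> set_decode (Suc (n div 2))" using Suc d by simp
    then show ?thesis using IH Suc by auto
  qed
  then show ?case by blast
qed

text \<open>From 2^i <= l and i < 2^i. It makes the bit relation increasing, as
  \<open>gadget\<close> demands, and later turns quantifiers over the elements of a coded set into
  bounded ones.\<close>

lemma set_decode_less: "i \<in> set_decode l \<Longrightarrow> i < l"
proof -
  assume "i \<in> set_decode l"
  then have "odd (l div 2 ^ i)" by (simp add: set_decode_def)
  then have "l div 2 ^ i \<noteq> 0" by (metis even_zero)
  then have "2 ^ i \<le> l" by (metis div_less not_less)
  then show ?thesis using less_exp[of i] by linarith
qed

lemma aev_bit_axiom: "aev K e bit_axiom"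
  unfolding fo_bit_axiom
proof (intro conjI ballI impI)
  fix v u assume "v \<in> {..<K}" "\<forall>u\<in>{..<K}. \<not> u < v" "u \<in> {..<K}"
  then have "v = 0" by (metis gr0I lessThan_iff less_trans)
  then show "u \<notin> set_decode v" by simp
next
  fix u v assume uv: "u \<in> {..<K}" "v \<in> {..<K}" "u < v \<and> \<not> (\<exists>w\<in>{..<K}. u < w \<and> w < v)"
  then have v: "v = Suc u" by (metis Suc_lessI lessI lessThan_iff less_trans)
  define i where "i = (LEAST i. i \<notin> set_decode u)"
  \<comment> \<open>Bit u of u is 0, so the least missing bit is at most u and belongs to the
    structure.\<close>
  have ex: "u \<notin> set_decode u" using set_decode_less by blast
  have i: "i \<notin> set_decode u" unfolding i_def by (rule LeastI[of "\<lambda>i. i \<notin> set_decode u", OF ex])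
  have "i \<le> u" unfolding i_def using ex by (rule Least_le)
  have j: "\<forall>j<i. j \<in> set_decode u" unfolding i_def using not_less_Least by blast
  have "set_decode v = insert i (set_decode u - {..<i})" unfolding v by (rule set_decode_carry[OF i j])
  then show "\<exists>i\<in>{..<K}. i \<notin> set_decode u \<and> i \<in> set_decode v \<and> (\<forall>j\<in>{..<K}. (j < i \<longrightarrow> j \<in> set_decode u \<and> j \<notin> set_decode v)
      \<and> (i < j \<longrightarrow> (j \<in> set_decode u \<longleftrightarrow> j \<in> set_decode v)))"
    using i j \<open>i \<le> u\<close> uv by (intro bexI[of _ i]) auto
qed

locale finite_order =
  fixes V :: "'a set" and lt :: "'a \<Rightarrow> 'a \<Rightarrow> bool"
  assumes fin: "finite V"
    and irrefl: "\<And>u. u \<in> V \<Longrightarrow> \<not> lt u u"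
    and trans: "\<And>u v w. u \<in> V \<Longrightarrow> v \<in> V \<Longrightarrow> w \<in> V \<Longrightarrow> lt u v \<Longrightarrow> lt v w \<Longrightarrow> lt u w"
    and total: "\<And>u v. u \<in> V \<Longrightarrow> v \<in> V \<Longrightarrow> lt u v \<or> u = v \<or> lt v u"
begin

definition rank :: "'a \<Rightarrow> nat" where
  "rank v = card {u \<in> V. lt u v}"

lemma rank_mono: assumes "u \<in> V" "v \<in> V" "lt u v" shows "rank u < rank v"
  unfolding rank_def
proof (rule psubset_card_mono)
  show "finite {w \<in> V. lt w v}" using fin by simp
  have "{w \<in> V. lt w u} \<subseteq> {w \<in> V. lt w v}" using assms trans by blast
  moreover have "u \<in> {w \<in> V. lt w v}" "u \<notin> {w \<in> V. lt w u}" using assms irrefl by auto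
  ultimately show "{w \<in> V. lt w u} \<subset> {w \<in> V. lt w v}" by blast
qed

lemma rank_less_iff: "u \<in> V \<Longrightarrow> v \<in> V \<Longrightarrow> lt u v \<longleftrightarrow> rank u < rank v"
  using rank_mono[of u v] rank_mono[of v u] total[of u v] by auto

lemma rank_image: "rank ` V = {..<card V}"
proof (rule card_subset_eq)
  have "{u \<in> V. lt u v} \<subset> V" if "v \<in> V" for v using that irrefl by blast
  then show "rank ` V \<subseteq> {..<card V}" unfolding rank_def using psubset_card_mono[OF fin] by blast
  have "inj_on rank V" by (rule inj_onI) (metis nat_neq_iff rank_mono total)
  then show "card (rank ` V) = card {..<card V}" by (simp add: card_image)
qed simp

text \<open>Induction along the order: the axiom fixes the members of v by those of its immediate
  predecessor p, and its witness i is forced to be the lowest bit missing from p.\<close>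

lemma bit_axiom_rank:
  assumes "fo V lt R e bit_axiom" "u \<in> V" "v \<in> V"
  shows "R u v \<longleftrightarrow> rank u \<in> set_decode (rank v)"
  using assms(2,3)
proof (induction "rank v" arbitrary: u v)
  case 0
  then have "\<forall>u\<in>V. \<not> lt u v" using rank_mono by fastforce
  then have "\<not> R u v" using assms(1) 0 unfolding fo_bit_axiom by blast
  then show ?case using 0(1) by (simp flip: 0(1))
next
  case (Suc n)
  have "Suc n < card V" using Suc.hyps(2) Suc.prems(2) rank_image by (metis imageI lessThan_iff)
  then have "n \<in> rank ` V" using rank_image by simp
  then obtain p where p: "p \<in> V" "rank p = n" by auto
  have ltp: "lt p v" using rank_less_iff[OF p(1) Suc.prems(2)] p Suc.hyps(2) by simp
  have "\<not> (\<exists>w\<in>V. lt p w \<and> lt w v)"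
    using rank_mono p Suc.hyps(2) Suc.prems(2) by (metis not_less_eq)
  then obtain i where i: "i \<in> V" "\<not> R i p" "R i v"
    "\<forall>j\<in>V. (lt j i \<longrightarrow> R j p \<and> \<not> R j v) \<and> (lt i j \<longrightarrow> (R j p \<longleftrightarrow> R j v))"
    using assms(1) p Suc.prems(2) ltp unfolding fo_bit_axiom by blast
  have IH: "R w p \<longleftrightarrow> rank w \<in> set_decode n" if "w \<in> V" for w
    using Suc.hyps(1)[OF p(2)[symmetric] that p(1)] p(2) by simp
  have "\<forall>j<rank i. j \<in> set_decode n"
  proof (intro allI impI)
    fix j assume j: "j < rank i"
    moreover have "rank i < card V" using rank_image i by blast
    ultimately have "j \<in> rank ` V" using rank_image by simp
    then obtain w where "w \<in> V" "rank w = j" by auto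
    then show "j \<in> set_decode n" using IH i rank_less_iff j by blast
  qed
  then have "set_decode (rank v) = insert (rank i) (set_decode n - {..<rank i})"
    using set_decode_carry[of "rank i" n] IH i Suc.hyps(2) by simp
  moreover have "lt u i \<longleftrightarrow> rank u < rank i" "lt i u \<longleftrightarrow> rank i < rank u" using rank_less_iff i Suc.prems by auto
  moreover have "u = i \<or> lt u i \<or> lt i u" using total i Suc.prems by blast
  ultimately show ?case using i IH[OF Suc.prems(1)] Suc.prems(1) by auto
qed

end

section \<open>Translation into the language of words\<close>

abbreviation (input) prefF :: "nat \<Rightarrow> fm" where
  "prefF z \<equiv> Conj (Neg (Lt (Var 0) (Var z))) (Lt (Var 0) (Dm 1 (Var z)))"

abbreviation (input) pointsF :: "nat \<Rightarrow> nat \<Rightarrow> fm" where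
  "pointsF w z \<equiv> Eq (Dm 1 (Dm 3 (Var w))) (Dm 1 (Var z))"

definition vertexF :: "nat \<Rightarrow> fm" where
  "vertexF z = Conj (prefF z) (Ex 1 (Conj (prefF 1) (pointsF 1 z)))"

definition edgeF :: "nat \<Rightarrow> nat \<Rightarrow> fm" where
  "edgeF u v = Ex 2 (Conj (prefF 2) (Conj (Lt (Var 2) (Var u))
     (Conj (Neg (Ex 3 (Conj (vertexF 3) (Conj (Lt (Var 3) (Var u)) (Neg (Lt (Var 3) (Var 2)))))))
       (pointsF 2 v))))"

text \<open>Variable 0 holds the word \<open>x\<close> that encodes the structure, 1 to 3 are auxiliary.
  Longer initial segments of \<open>x\<close> are larger words, so the order is reversed.\<close>

primrec tr :: "af \<Rightarrow> fm" where
  "tr (ALt u v) = Lt (Var (v + 4)) (Var (u + 4))"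
| "tr (AMem u v) = edgeF (u + 4) (v + 4)"
| "tr (ANeg \<phi>) = Neg (tr \<phi>)"
| "tr (AAnd \<phi> \<psi>) = Conj (tr \<phi>) (tr \<psi>)"
| "tr (AEx x \<phi>) = Ex (x + 4) (Conj (vertexF (x + 4)) (tr \<phi>))"

text \<open>\<open>vertexF\<close> does not express that its value lies in
  \<open>WN \<alpha>\<close>; in a translated formula the quantifier \<open>Ex\<close> provides
  this.\<close>

lemma sat_vertexF:
  "z \<notin> {0, 1} \<Longrightarrow> sat \<alpha> e (vertexF z) \<and> e z \<in> WN \<alpha> \<longleftrightarrow> vertex \<alpha> (e 0) (e z)"
  by (auto simp: vertexF_def vertex_def pref_def points_def not_wle[symmetric])

lemma sat_edgeF:
  assumes "3 < u" "3 < v"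
  shows "sat \<alpha> e (edgeF u v) \<longleftrightarrow> edge \<alpha> (e 0) (e u) (e v)"
proof -
  have "sat \<alpha> (e(2 := w, 3 := v')) (vertexF 3) \<longleftrightarrow> vertex \<alpha> (e 0) v'" if "v' \<in> WN \<alpha>" for w v'
    using sat_vertexF[of 3 \<alpha> "e(2 := w, 3 := v')"] that by simp
  then show ?thesis unfolding edgeF_def edge_def using assms
    by (simp add: pref_def points_def not_wle[symmetric] conj_ac cong: bex_cong conj_cong)
qed

lemma sat_tr:
  "sat \<alpha> e (tr \<phi>) \<longleftrightarrow> fo {z. vertex \<alpha> (e 0) z} (\<lambda>u v. wless v u) (edge \<alpha> (e 0)) (\<lambda>v. e (v + 4)) \<phi>"
proof (induction \<phi> arbitrary: e)
  case (AEx x \<phi>)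
  have s: "(\<lambda>v. (e(x + 4 := w)) (v + 4)) = (\<lambda>v. e (v + 4))(x := w)" for w by auto
  have "sat \<alpha> e (tr (AEx x \<phi>)) \<longleftrightarrow>
    (\<exists>w. (sat \<alpha> (e(x + 4 := w)) (vertexF (x + 4)) \<and> w \<in> WN \<alpha>) \<and> sat \<alpha> (e(x + 4 := w)) (tr \<phi>))"
    by auto
  also have "\<dots> \<longleftrightarrow> (\<exists>w. vertex \<alpha> (e 0) w \<and> sat \<alpha> (e(x + 4 := w)) (tr \<phi>))"
    using sat_vertexF[of "x + 4" \<alpha> "e(x + 4 := w)" for w] by simp
  finally show ?case unfolding AEx.IH s by simp
qed (auto simp: sat_edgeF)

lemma fwf_tr: assumes "3 \<le> \<alpha>" shows "fwf \<alpha> (tr \<phi>)"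
proof -
  have "enat 1 \<le> \<alpha>" "enat 3 \<le> \<alpha>"
    using assms by (metis enat_ord_simps(1) numeral_eq_enat order_trans one_le_numeral)+
  then show ?thesis by (induction \<phi>) (auto simp: vertexF_def edgeF_def)
qed

lemma fvars_tr: "fvars (tr \<phi>) \<subseteq> insert 0 ((\<lambda>v. v + 4) ` afv \<phi>)"
  by (induction \<phi>) (auto simp: vertexF_def edgeF_def)

definition sentence :: "af \<Rightarrow> fm" where
  "sentence \<phi> = Ex 0 (tr (AAnd bit_axiom \<phi>))"

text \<open>A word x may encode any graph at all, but \<open>bit_axiom\<close> leaves only those
  that \<open>rank\<close> identifies with a segment of the numbers. Conversely
  \<open>gadget\<close> supplies a word for every K.\<close>

lemma sat_sentence:
  assumes "3 \<le> \<alpha>" "afv \<phi> = {}"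
  shows "sat \<alpha> e (sentence \<phi>) \<longleftrightarrow> (\<exists>K e. aev K e \<phi>)"
proof
  assume "sat \<alpha> e (sentence \<phi>)"
  then obtain x e' where x: "x \<in> WN \<alpha>"
    and s: "fo {z. vertex \<alpha> x z} (\<lambda>u v. wless v u) (edge \<alpha> x) e' (AAnd bit_axiom \<phi>)"
    by (auto simp: sentence_def sat_tr simp del: tr.simps fo.simps)
  interpret finite_order "{z. vertex \<alpha> x z}" "\<lambda>u v. wless v u"
  proof
    show "finite {z. vertex \<alpha> x z}" by (rule finite_vertex[OF x])
    show "wless v u \<or> u = v \<or> wless u v" if "u \<in> {z. vertex \<alpha> x z}" "v \<in> {z. vertex \<alpha> x z}" for u v
      using NF_linear[of u v] that by (auto simp: vertex_def WN_def)
    show "wless w u" if "wless v u" "wless w v" for u v w using that wless_trans by blast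
  qed simp
  have "fo {z. vertex \<alpha> x z} (\<lambda>u v. wless v u) (edge \<alpha> x) e' \<phi> = aev (card {z. vertex \<alpha> x z}) (rank \<circ> e') \<phi>"
    by (rule fo_iso) (use rank_image rank_less_iff bit_axiom_rank s assms(2) in auto)
  then show "\<exists>K e. aev K e \<phi>" using s by auto
next
  assume "\<exists>K e. aev K e \<phi>"
  then obtain K f where K: "aev K f \<phi>" by blast
  obtain x h where x: "x \<in> WN \<alpha>" and h: "{z. vertex \<alpha> x z} = h ` {..<K}"
    "\<forall>i<K. \<forall>j<K. (wless (h j) (h i) \<longleftrightarrow> i < j) \<and> (edge \<alpha> x (h i) (h j) \<longleftrightarrow> i \<in> set_decode j)"
    using gadget[OF assms(1), of "\<lambda>i j. i \<in> set_decode j" K] set_decode_less by blast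
  define \<psi> where "\<psi> = AAnd bit_axiom \<phi>"
  have \<psi>: "afv \<psi> = {}" by (simp add: \<psi>_def afv_bit_axiom assms(2))
  have "aev K f \<psi>" using K aev_bit_axiom by (simp add: \<psi>_def)
  also have "aev K f \<psi> = fo {z. vertex \<alpha> x z} (\<lambda>u v. wless v u) (edge \<alpha> x) (h \<circ> f) \<psi>"
    by (rule fo_iso) (use h \<psi> in auto)
  also have "\<dots> = fo {z. vertex \<alpha> x z} (\<lambda>u v. wless v u) (edge \<alpha> x) (\<lambda>v. (e(0 := x)) (v + 4)) \<psi>"
    by (rule fo_cong) (use \<psi> in simp)
  finally have "sat \<alpha> (e(0 := x)) (tr \<psi>)" unfolding sat_tr by simp
  then show "sat \<alpha> e (sentence \<phi>)" using x unfolding sentence_def \<psi>_def by auto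
qed

lemma sentence_in_Th:
  assumes "3 \<le> \<alpha>" "afv \<phi> = {}"
  shows "sentence \<phi> \<in> Th \<alpha> \<longleftrightarrow> (\<exists>K e. aev K e \<phi>)"
proof -
  have "fvars (sentence \<phi>) = {}"
    using fvars_tr[of "AAnd bit_axiom \<phi>"] assms(2) afv_bit_axiom by (auto simp: sentence_def)
  moreover have "fwf \<alpha> (sentence \<phi>)"
    using fwf_tr[OF assms(1)] unfolding sentence_def fwf.simps by blast
  ultimately show ?thesis unfolding Th_def using sat_sentence[OF assms] by simp
qed

section \<open>Recursive functions over bit structures\<close>

text \<open>\<open>\<Sigma>\<^sub>1\<close>-definability over the natural numbers with the bit relation, expressed through the
  finite initial segments.\<close>

definition sigma_def :: "((nat \<Rightarrow> nat) \<Rightarrow> bool) \<Rightarrow> bool" where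
  "sigma_def P \<longleftrightarrow> (\<exists>\<phi>. (\<forall>K e. (\<forall>i. e i < K) \<longrightarrow> aev K e \<phi> \<longrightarrow> P e) \<and>
     (\<forall>e. P e \<longrightarrow> (\<exists>K0. \<forall>K\<ge>K0. (\<forall>i. e i < K) \<longrightarrow> aev K e \<phi>)))"

text \<open>Existential definitions cannot in general be negated. Formulas that are exact in every
  finite segment can, and the negated atoms below are obtained in this way.\<close>

lemma sigma_exact: "(\<And>K e. \<forall>i. e i < K \<Longrightarrow> aev K e \<phi> \<longleftrightarrow> P e) \<Longrightarrow> sigma_def P"
  unfolding sigma_def_def by blast

text \<open>Two bounds can be combined by taking the maximum because \<open>sigma_def\<close> asks
  for truth in all large segments and not just in one.\<close>

lemma sigma_conj:
  assumes "sigma_def P" "sigma_def Q" shows "sigma_def (\<lambda>e. P e \<and> Q e)"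
proof -
  obtain \<phi> where p: "\<And>K e. (\<forall>i. e i < K) \<Longrightarrow> aev K e \<phi> \<Longrightarrow> P e"
    "\<And>e. P e \<Longrightarrow> \<exists>K0. \<forall>K\<ge>K0. (\<forall>i. e i < K) \<longrightarrow> aev K e \<phi>" using assms(1) unfolding sigma_def_def by blast
  obtain \<psi> where q: "\<And>K e. (\<forall>i. e i < K) \<Longrightarrow> aev K e \<psi> \<Longrightarrow> Q e"
    "\<And>e. Q e \<Longrightarrow> \<exists>K0. \<forall>K\<ge>K0. (\<forall>i. e i < K) \<longrightarrow> aev K e \<psi>" using assms(2) unfolding sigma_def_def by blast
  have "\<exists>K0. \<forall>K\<ge>K0. (\<forall>i. e i < K) \<longrightarrow> aev K e (AAnd \<phi> \<psi>)" if PQ: "P e \<and> Q e" for e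
  proof -
    obtain k l where k: "\<forall>K\<ge>k. (\<forall>i. e i < K) \<longrightarrow> aev K e \<phi>" "\<forall>K\<ge>l. (\<forall>i. e i < K) \<longrightarrow> aev K e \<psi>"
      using p(2)[of e] q(2)[of e] PQ by blast
    show ?thesis by (rule exI[of _ "max k l"]) (use k in simp)
  qed
  then show ?thesis unfolding sigma_def_def using p(1) q(1) by (intro exI[of _ "AAnd \<phi> \<psi>"]) auto
qed

lemma sigma_disj:
  assumes "sigma_def P" "sigma_def Q" shows "sigma_def (\<lambda>e. P e \<or> Q e)"
proof -
  obtain \<phi> where p: "\<And>K e. (\<forall>i. e i < K) \<Longrightarrow> aev K e \<phi> \<Longrightarrow> P e"
    "\<And>e. P e \<Longrightarrow> \<exists>K0. \<forall>K\<ge>K0. (\<forall>i. e i < K) \<longrightarrow> aev K e \<phi>" using assms(1) unfolding sigma_def_def by blast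
  obtain \<psi> where q: "\<And>K e. (\<forall>i. e i < K) \<Longrightarrow> aev K e \<psi> \<Longrightarrow> Q e"
    "\<And>e. Q e \<Longrightarrow> \<exists>K0. \<forall>K\<ge>K0. (\<forall>i. e i < K) \<longrightarrow> aev K e \<psi>" using assms(2) unfolding sigma_def_def by blast
  have "\<exists>K0. \<forall>K\<ge>K0. (\<forall>i. e i < K) \<longrightarrow> aev K e \<phi> \<or> aev K e \<psi>" if "P e \<or> Q e" for e
    using that p(2)[of e] q(2)[of e] by blast
  then show ?thesis unfolding sigma_def_def using p(1) q(1)
    by (intro exI[of _ "ANeg (AAnd (ANeg \<phi>) (ANeg \<psi>))"]) auto
qed

lemma sigma_ex:
  assumes "sigma_def P" shows "sigma_def (\<lambda>e. \<exists>v. P (e(x := v)))"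
proof -
  obtain \<phi> where p: "\<And>K e. (\<forall>i. e i < K) \<Longrightarrow> aev K e \<phi> \<Longrightarrow> P e"
    "\<And>e. P e \<Longrightarrow> \<exists>K0. \<forall>K\<ge>K0. (\<forall>i. e i < K) \<longrightarrow> aev K e \<phi>" using assms(1) unfolding sigma_def_def by blast
  have "\<exists>v. P (e(x := v))" if "\<forall>i. e i < K" "aev K e (AEx x \<phi>)" for K e
  proof -
    obtain v where "v < K" "aev K (e(x := v)) \<phi>" using \<open>aev K e (AEx x \<phi>)\<close> by auto
    moreover from this have "\<forall>i. (e(x := v)) i < K" using that(1) by simp
    ultimately show ?thesis using p(1) by blast
  qed
  moreover have "\<exists>K0. \<forall>K\<ge>K0. (\<forall>i. e i < K) \<longrightarrow> aev K e (AEx x \<phi>)" if Pv: "P (e(x := v))" for e v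
  proof -
    obtain k where k: "\<forall>K\<ge>k. (\<forall>i. (e(x := v)) i < K) \<longrightarrow> aev K (e(x := v)) \<phi>" using p(2)[OF Pv] by blast
    show ?thesis
    proof (intro exI[of _ "max k (Suc v)"] allI impI)
      fix K assume K: "max k (Suc v) \<le> K" "\<forall>i. e i < K"
      then have "\<forall>i. (e(x := v)) i < K" by simp
      then have "aev K (e(x := v)) \<phi>" using k K by simp
      then show "aev K e (AEx x \<phi>)" using K by (auto intro!: bexI[of _ v])
    qed
  qed
  ultimately show ?thesis unfolding sigma_def_def by (intro exI[of _ "AEx x \<phi>"]) blast
qed

lemma sigma_ball:
  assumes "sigma_def P" "x \<noteq> y" shows "sigma_def (\<lambda>e. \<forall>v<e y. P (e(x := v)))"
proof -
  obtain \<phi> where p: "\<And>K e. (\<forall>i. e i < K) \<Longrightarrow> aev K e \<phi> \<Longrightarrow> P e"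
    "\<And>e. P e \<Longrightarrow> \<exists>K0. \<forall>K\<ge>K0. (\<forall>i. e i < K) \<longrightarrow> aev K e \<phi>" using assms(1) unfolding sigma_def_def by blast
  define \<psi> where "\<psi> = AAll x (AImp (ALt x y) \<phi>)"
  have \<psi>: "aev K e \<psi> \<longleftrightarrow> (\<forall>v<K. v < e y \<longrightarrow> aev K (e(x := v)) \<phi>)" for K e
    using assms(2) by (auto simp: \<psi>_def)
  have "\<forall>v<e y. P (e(x := v))" if e: "\<forall>i. e i < K" "aev K e \<psi>" for K e
  proof (intro allI impI)
    fix v assume v: "v < e y"
    then have vK: "v < K" using e(1) by (metis less_trans)
    then have "\<forall>i. (e(x := v)) i < K" using e(1) by simp
    then show "P (e(x := v))" using p(1) e(2) v vK unfolding \<psi> by blast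
  qed
  moreover have "\<exists>K0. \<forall>K\<ge>K0. (\<forall>i. e i < K) \<longrightarrow> aev K e \<psi>" if P: "\<forall>v<e y. P (e(x := v))" for e
  proof -
    have "\<forall>v\<in>{..<e y}. \<exists>K0. \<forall>K\<ge>K0. (\<forall>i. (e(x := v)) i < K) \<longrightarrow> aev K (e(x := v)) \<phi>" using P p(2) by blast
    then obtain k where k: "\<forall>v\<in>{..<e y}. \<forall>K\<ge>k v. (\<forall>i. (e(x := v)) i < K) \<longrightarrow> aev K (e(x := v)) \<phi>"
      by (meson bchoice)
    \<comment> \<open>Only finitely many v lie below \<open>e y\<close>, so their bounds have a
      maximum; 0 is inserted for the case \<open>e y = 0\<close>.\<close>
    define m where "m = Max (insert 0 (k ` {..<e y}))"
    have m: "k v \<le> m" if "v < e y" for v unfolding m_def using that by (intro Max_ge) auto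
    show ?thesis
    proof (intro exI[of _ m] allI impI)
      fix K assume K: "m \<le> K" "\<forall>i. e i < K"
      show "aev K e \<psi>" unfolding \<psi>
      proof (intro allI impI)
        fix v assume v: "v < K" "v < e y"
        then have "\<forall>i. (e(x := v)) i < K" using K by simp
        moreover have "k v \<le> K" using m[OF v(2)] K by simp
        ultimately show "aev K (e(x := v)) \<phi>" using k v by blast
      qed
    qed
  qed
  ultimately show ?thesis unfolding sigma_def_def by blast
qed

lemma sigma_mem: "sigma_def (\<lambda>e. e u \<in> set_decode (e v))"
  by (rule sigma_exact[of "AMem u v"]) simp

lemma sigma_not_mem: "sigma_def (\<lambda>e. e u \<notin> set_decode (e v))"
  by (rule sigma_exact[of "ANeg (AMem u v)"]) simp

lemma sigma_eq: "sigma_def (\<lambda>e. e u = e v)"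
  by (rule sigma_exact[of "AEq u v"]) auto

lemma sigma_False: "sigma_def (\<lambda>e. False)"
  by (rule sigma_exact[of "ALt 0 0"]) auto

lemma aev_zero:
  assumes "u \<noteq> w" "\<forall>i. e i < K"
  shows "aev K e (ANeg (AEx w (ALt w u))) \<longleftrightarrow> e u = 0"
proof -
  have "aev K e (ANeg (AEx w (ALt w u))) \<longleftrightarrow> \<not> (\<exists>a<K. a < e u)" using assms(1) by auto
  also have "\<dots> \<longleftrightarrow> \<not> 0 < e u"
  proof -
    have "(\<exists>a<K. a < e u) \<longleftrightarrow> 0 < e u"
    proof
      assume u: "0 < e u"
      have "e u < K" using assms(2) ..
      with u have "0 < K" by simp
      with u show "\<exists>a<K. a < e u" by blast
    qed auto
    then show ?thesis by simp
  qed
  finally show ?thesis by simp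
qed

lemma sigma_zero: "sigma_def (\<lambda>e. e u = 0)"
  by (rule sigma_exact[of "ANeg (AEx (Suc u) (ALt (Suc u) u))"]) (rule aev_zero; simp)

lemma sigma_nonzero: "sigma_def (\<lambda>e. e u \<noteq> 0)"
  by (rule sigma_exact[of "ANeg (ANeg (AEx (Suc u) (ALt (Suc u) u)))"]) (use aev_zero[of u "Suc u"] in simp)

lemma aev_Suc:
  assumes "w \<noteq> u" "w \<noteq> v" "e u < K" "e v < K"
  shows "aev K e (ASucc w u v) \<longleftrightarrow> e v = Suc (e u)"
proof -
  have "aev K e (ASucc w u v) \<longleftrightarrow> e u < e v \<and> \<not> (\<exists>a<K. e u < a \<and> a < e v)" using assms by auto
  also have "\<dots> \<longleftrightarrow> e v = Suc (e u)"
  proof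
    assume a: "e u < e v \<and> \<not> (\<exists>a<K. e u < a \<and> a < e v)"
    show "e v = Suc (e u)"
    proof (rule ccontr)
      assume "e v \<noteq> Suc (e u)"
      then have "Suc (e u) < e v" using a by simp
      then show False using a assms(4) by (metis lessI less_trans)
    qed
  qed simp
  finally show ?thesis .
qed

lemma sigma_Suc: "sigma_def (\<lambda>e. e v = Suc (e u))"
  by (rule sigma_exact[of "ASucc (Suc (u + v)) u v"]) (rule aev_Suc; simp)

lemma sigma_doubleton: "sigma_def (\<lambda>e. set_decode (e u) = {e a, e b})"
proof -
  define w where "w = Suc (u + a + b)"
  have w: "w \<noteq> u" "w \<noteq> a" "w \<noteq> b" by (auto simp: w_def)
  show ?thesis
  proof (rule sigma_exact[of "AAnd (AMem a u) (AAnd (AMem b u)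
      (AAll w (AImp (AMem w u) (ANeg (AAnd (ANeg (AEq w a)) (ANeg (AEq w b)))))))"])
    fix K and e :: "nat \<Rightarrow> nat" assume e: "\<forall>i. e i < K"
    have eq: "c = d \<longleftrightarrow> \<not> c < d \<and> \<not> d < c" for c d :: nat by auto
    have "aev K e (AAll w (AImp (AMem w u) (ANeg (AAnd (ANeg (AEq w a)) (ANeg (AEq w b))))))
      \<longleftrightarrow> (\<forall>c<K. c \<in> set_decode (e u) \<longrightarrow> c = e a \<or> c = e b)"
      using w unfolding eq by simp blast
    also have "\<dots> \<longleftrightarrow> set_decode (e u) \<subseteq> {e a, e b}"
      using e set_decode_less less_trans by blast
    finally show "aev K e (AAnd (AMem a u) (AAnd (AMem b u)
      (AAll w (AImp (AMem w u) (ANeg (AAnd (ANeg (AEq w a)) (ANeg (AEq w b)))))))) \<longleftrightarrow> set_decode (e u) = {e a, e b}"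
      unfolding fo.simps(4)[of _ _ _ _ "AMem a u"] fo.simps(4)[of _ _ _ _ "AMem b u"] fo.simps(2) by blast
  qed
qed

text \<open>The Kuratowski pair of hereditarily finite sets. It is definable from membership alone,
  without any arithmetic, and \<open>{a, a}\<close> lets \<open>sigma_doubleton\<close> serve for
  both members.\<close>

definition pr :: "nat \<Rightarrow> nat \<Rightarrow> nat" where
  "pr a b = set_encode {set_encode {a, a}, set_encode {a, b}}"

lemma pr_inject: "pr a b = pr c d \<longleftrightarrow> a = c \<and> b = d"
proof -
  have E: "set_encode {a, b} = set_encode {c, d} \<longleftrightarrow> {a, b} = {c, d}" for a b c d
    by (intro set_encode_eq) simp_all
  show ?thesis unfolding pr_def E doubleton_eq_iff by auto
qed

lemma sigma_pr: "sigma_def (\<lambda>e. e p = pr (e a) (e b))"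
proof -
  define s where "s = Suc (p + a + b)"
  define t where "t = Suc s"
  have st: "s \<noteq> p" "s \<noteq> a" "s \<noteq> b" "t \<noteq> s" "t \<noteq> p" "t \<noteq> a" "t \<noteq> b" by (auto simp: s_def t_def)
  define Q where "Q e \<longleftrightarrow> set_decode (e s) = {e a, e a} \<and>
     set_decode (e t) = {e a, e b} \<and> set_decode (e p) = {e s, e t}" for e
  have "(\<lambda>e. e p = pr (e a) (e b)) = (\<lambda>e. \<exists>x y. Q (e(s := x, t := y)))" (is "?L = ?R")
  proof
    fix e
    have "?R e \<longleftrightarrow> (\<exists>x y. set_decode x = {e a} \<and> set_decode y = {e a, e b} \<and> set_decode (e p) = {x, y})"
      using st by (simp add: Q_def)
    also have "\<dots> \<longleftrightarrow> set_decode (e p) = {set_encode {e a}, set_encode {e a, e b}}"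
      by (metis finite.emptyI finite.insertI set_decode_inverse set_encode_inverse)
    also have "\<dots> \<longleftrightarrow> e p = pr (e a) (e b)"
      unfolding pr_def by (metis finite.emptyI finite.insertI insert_absorb2 set_decode_inverse set_encode_inverse)
    finally show "?L e = ?R e" by simp
  qed
  moreover have "sigma_def Q" unfolding Q_def by (intro sigma_conj sigma_doubleton)
  then have "sigma_def (\<lambda>e. \<exists>x y. Q (e(s := x, t := y)))" by (rule sigma_ex[OF sigma_ex])
  ultimately show ?thesis by simp
qed

section \<open>Graphs of recursive functions\<close>

lemma reval_Zf: "reval Zf xs y \<longleftrightarrow> y = 0"
  by (subst reval.simps) auto

lemma reval_Sf: "reval Sf xs y \<longleftrightarrow> (\<exists>x ys. xs = x # ys \<and> y = Suc x)"
  by (subst reval.simps) auto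

lemma reval_Proj: "reval (Proj i) xs y \<longleftrightarrow> i < length xs \<and> y = xs ! i"
  by (subst reval.simps) auto

lemma reval_Comp: "reval (Comp f gs) xs y \<longleftrightarrow> (\<exists>ys. list_all2 (\<lambda>g y. reval g xs y) gs ys \<and> reval f ys y)"
  by (subst reval.simps) auto

lemma reval_Prim_Nil: "\<not> reval (Prim f g) [] y"
  by (subst reval.simps) auto

lemma reval_Prim_0: "reval (Prim f g) (0 # xs) y \<longleftrightarrow> reval f xs y"
  by (subst reval.simps) auto

lemma reval_Prim_Suc:
  "reval (Prim f g) (Suc n # xs) y \<longleftrightarrow> (\<exists>z. reval (Prim f g) (n # xs) z \<and> reval g (z # n # xs) y)"
  by (subst reval.simps) auto

lemma reval_Mn: "reval (Mn f) xs y \<longleftrightarrow> reval f (y # xs) 0 \<and> (\<forall>z<y. \<exists>v. v \<noteq> 0 \<and> reval f (z # xs) v)"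
  by (subst reval.simps) auto

lemma reval_det: "reval f xs y \<Longrightarrow> reval f xs y' \<Longrightarrow> y = y'"
proof (induction arbitrary: y' rule: reval.induct)
  case (4 xs gs ys f y)
  then obtain zs where zs: "list_all2 (\<lambda>g y. reval g xs y) gs zs" "reval f zs y'" by (auto simp: reval_Comp)
  have "ys = zs" using 4(1) zs(1)
  proof (induction gs ys arbitrary: zs rule: list_all2_induct)
    case Nil then show ?case by simp
  next
    case (Cons g gs y ys) then show ?case by (cases zs) auto
  qed
  then show ?case using 4 zs by blast
next
  case (5 f xs y g) then show ?case by (simp add: reval_Prim_0)
next
  case (6 f g n xs z y) then show ?case unfolding reval_Prim_Suc by blast
next
  case (7 f y xs)
  then have r: "reval f (y' # xs) 0" "\<forall>z<y'. \<exists>v. v \<noteq> 0 \<and> reval f (z # xs) v" by (auto simp: reval_Mn)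
  show ?case
  proof (cases y y' rule: linorder_cases)
    case less then show ?thesis using r(2) 7 by blast
  next
    case greater then show ?thesis using r(1) 7 by blast
  qed
qed (auto simp: reval_Zf reval_Sf reval_Proj)

text \<open>A computation by primitive recursion is witnessed by a finite set of pairs
  (argument, value) each of which is justified by the set.\<close>

lemma reval_Prim_set:
  "reval (Prim f g) (n # xs) y \<longleftrightarrow>
    (\<exists>s. pr n y \<in> set_decode s \<and> (\<forall>p\<in>set_decode s. \<exists>i v. p = pr i v \<and> (i = 0 \<and> reval f xs v \<or>
       (\<exists>j u. i = Suc j \<and> pr j u \<in> set_decode s \<and> reval g (u # j # xs) v))))"
  (is "_ \<longleftrightarrow> (\<exists>s. pr n y \<in> set_decode s \<and> ?closed (set_decode s))")
proof
  assume "\<exists>s. pr n y \<in> set_decode s \<and> ?closed (set_decode s)"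
  then obtain s where s: "pr n y \<in> set_decode s" "?closed (set_decode s)" by blast
  have "pr i v \<in> set_decode s \<Longrightarrow> reval (Prim f g) (i # xs) v" for i v
  proof (induction i arbitrary: v)
    case 0
    then have "reval f xs v" using s(2) by (auto simp: pr_inject)
    then show ?case by (simp add: reval_Prim_0)
  next
    case (Suc i)
    then obtain u where "pr i u \<in> set_decode s" "reval g (u # i # xs) v"
      using s(2) by (fastforce simp: pr_inject)
    then show ?case using Suc.IH unfolding reval_Prim_Suc by blast
  qed
  then show "reval (Prim f g) (n # xs) y" using s by blast
next
  have "reval (Prim f g) (n # xs) y \<Longrightarrow> \<exists>S. finite S \<and> pr n y \<in> S \<and> ?closed S" for y
  proof (induction n arbitrary: y)
    case 0
    then have "reval f xs y" by (simp add: reval_Prim_0)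
    then show ?case by (intro exI[of _ "{pr 0 y}"]) auto
  next
    case (Suc n)
    then obtain z where z: "reval (Prim f g) (n # xs) z" "reval g (z # n # xs) y"
      unfolding reval_Prim_Suc by blast
    then obtain S where "finite S" "pr n z \<in> S" "?closed S" using Suc.IH by blast
    then show ?case using z by (intro exI[of _ "insert (pr (Suc n) y) S"]) fastforce
  qed
  then show "reval (Prim f g) (n # xs) y \<Longrightarrow> \<exists>s. pr n y \<in> set_decode s \<and> ?closed (set_decode s)"
    by (metis (no_types, lifting) set_encode_inverse)
qed

lemma sigma_reval_Prim:
  assumes f: "\<And>vs r. sigma_def (\<lambda>e. reval f (map e vs) (e r))"
    and g: "\<And>vs r. sigma_def (\<lambda>e. reval g (map e vs) (e r))"
  shows "sigma_def (\<lambda>e. reval (Prim f g) (map e vs) (e r))"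
proof (cases vs)
  case Nil
  then show ?thesis using sigma_False by (simp add: reval_Prim_Nil)
next
  case (Cons n xs)
  define m where "m = Suc (Max (set (r # n # xs)))"
  have "v < m" if "v \<in> set (r # n # xs)" for v
    unfolding m_def using Max_ge[OF _ that] by (simp only: less_Suc_eq_le) simp
  then have less: "r < m" "n < m" "\<And>v. v \<in> set xs \<Longrightarrow> v < m" by auto
  obtain s p i v j u q c where vars: "s = m" "p = m + 1" "i = m + 2" "v = m + 3" "j = m + 4" "u = m + 5"
    "q = m + 6" "c = m + 7" by blast
  have fresh: "distinct [r, s, p, i, v, j, u, q, c]" "distinct [n, s, p, i, v, j, u, q, c]"
    "distinct [c, q, u, j, v, i, p, s, r]" "distinct [c, q, u, j, v, i, p, s, n]"
    using less(1,2) by (simp_all add: vars)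
  have frx: "s \<notin> set xs" "p \<notin> set xs" "i \<notin> set xs" "v \<notin> set xs" "j \<notin> set xs" "u \<notin> set xs"
    "q \<notin> set xs" "c \<notin> set xs"
    using less(3) unfolding vars by fastforce+
  \<comment> \<open>Variable s holds the justified set and p one of its elements, the pair of i and
    v; q is the pair of j and u from the preceding stage, and c is the pair of argument and result
    to be found in s.\<close>
  define A where "A e \<longleftrightarrow> e i = Suc (e j) \<and> e q = pr (e j) (e u) \<and> e q \<in> set_decode (e s) \<and>
    reval g (map e (u # j # xs)) (e v)" for e
  define B where "B e \<longleftrightarrow> e p = pr (e i) (e v) \<and> (e i = 0 \<and> reval f (map e xs) (e v) \<or>
    (\<exists>a b d. A (e(j := a, u := b, q := d))))" for e
  define C where "C e \<longleftrightarrow> e p \<notin> set_decode (e s) \<or> (\<exists>a b. B (e(i := a, v := b)))" for e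
  \<comment> \<open>Elements of a coded set are smaller than its code, so the universal quantifier
    over p can be bounded by s, as \<open>sigma_ball\<close> requires.\<close>
  define D where "D e \<longleftrightarrow> (e c = pr (e n) (e r) \<and> e c \<in> set_decode (e s)) \<and> (\<forall>a<e s. C (e(p := a)))" for e
  have A: "sigma_def A" unfolding A_def by (intro sigma_conj sigma_Suc sigma_pr sigma_mem g)
  have B: "sigma_def B" unfolding B_def
    by (intro sigma_conj sigma_disj sigma_pr sigma_zero f sigma_ex[OF sigma_ex[OF sigma_ex[OF A]]])
  have C: "sigma_def C" unfolding C_def
    by (intro sigma_disj sigma_not_mem sigma_ex[OF sigma_ex[OF B]])
  have "p \<noteq> s" using fresh by auto
  then have D: "sigma_def D" unfolding D_def
    by (intro sigma_conj sigma_pr sigma_mem sigma_ball[OF C])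
  have DD: "sigma_def (\<lambda>e. \<exists>a b. D (e(s := a, c := b)))" by (rule sigma_ex[OF sigma_ex[OF D]])
  have exA: "(\<exists>a b d. A (e(j := a, u := b, q := d))) \<longleftrightarrow>
      (\<exists>j u. e i = Suc j \<and> pr j u \<in> set_decode (e s) \<and> reval g (u # j # map e xs) (e v))" for e
    using fresh frx by (simp add: A_def)
  define just where "just S ys p \<longleftrightarrow> (\<exists>i v. p = pr i v \<and> (i = 0 \<and> reval f ys v \<or>
       (\<exists>j u. i = Suc j \<and> pr j u \<in> S \<and> reval g (u # j # ys) v)))" for S ys p
  have exB: "(\<exists>a b. B (e(i := a, v := b))) \<longleftrightarrow> just (set_decode (e s)) (map e xs) (e p)" for e
    unfolding B_def exA just_def using fresh frx by simp
  have exD: "D (e(s := a, c := b)) \<longleftrightarrow> b = pr (e n) (e r) \<and> b \<in> set_decode a \<and>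
      (\<forall>p<a. p \<notin> set_decode a \<or> just (set_decode a) (map e xs) p)" for e a b
    unfolding D_def C_def exB using fresh frx by simp
  have "(\<lambda>e. reval (Prim f g) (map e vs) (e r)) = (\<lambda>e. \<exists>a b. D (e(s := a, c := b)))"
  proof
    fix e
    have "(\<exists>a b. D (e(s := a, c := b))) \<longleftrightarrow>
      (\<exists>s. pr (e n) (e r) \<in> set_decode s \<and> (\<forall>p\<in>set_decode s. just (set_decode s) (map e xs) p))"
      unfolding exD using set_decode_less by blast
    also have "\<dots> \<longleftrightarrow> reval (Prim f g) (e n # map e xs) (e r)"
      unfolding reval_Prim_set just_def ..
    finally show "reval (Prim f g) (map e vs) (e r) = (\<exists>a b. D (e(s := a, c := b)))" using Cons by simp
  qed
  then show ?thesis using DD by simp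
qed

lemma ex_fresh: "\<exists>w. w \<notin> set (vs :: nat list)"
  using ex_new_if_finite[OF infinite_UNIV_nat, of "set vs"] by blast

text \<open>The variables \<open>us\<close> hold the results of the inner functions already treated;
  each further function adds one fresh variable.\<close>

lemma sigma_reval_Comp:
  assumes f: "\<And>vs r. sigma_def (\<lambda>e. reval f (map e vs) (e r))"
    and g: "\<And>g vs r. g \<in> set gs \<Longrightarrow> sigma_def (\<lambda>e. reval g (map e vs) (e r))"
  shows "sigma_def (\<lambda>e. \<exists>ys. list_all2 (\<lambda>g y. reval g (map e vs) y) gs ys \<and> reval f (map e us @ ys) (e r))"
  using g
proof (induction gs arbitrary: us)
  case Nil
  then show ?case using f by simp
next
  case (Cons g gs)
  obtain w where w: "w \<notin> set (r # vs @ us)" using ex_fresh by blast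
  define P where "P e \<longleftrightarrow> reval g (map e vs) (e w) \<and>
    (\<exists>ys. list_all2 (\<lambda>g y. reval g (map e vs) y) gs ys \<and> reval f (map e (us @ [w]) @ ys) (e r))" for e
  have "sigma_def P" unfolding P_def
    by (intro sigma_conj Cons.prems Cons.IH) auto
  then have "sigma_def (\<lambda>e. \<exists>v. P (e(w := v)))" by (rule sigma_ex)
  moreover have "(\<exists>v. P (e(w := v))) \<longleftrightarrow>
    (\<exists>ys. list_all2 (\<lambda>g y. reval g (map e vs) y) (g # gs) ys \<and> reval f (map e us @ ys) (e r))" for e
    using w by (auto simp: P_def list_all2_Cons1)
  ultimately show ?case by simp
qed

lemma sigma_reval: "sigma_def (\<lambda>e. reval f (map e vs) (e r))"
proof (induction f arbitrary: vs r)
  case Zf show ?case using sigma_zero by (simp add: reval_Zf)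
next
  case Sf show ?case
  proof (cases vs)
    case Nil then show ?thesis using sigma_False by (simp add: reval_Sf)
  next
    case (Cons v vs') then show ?thesis using sigma_Suc by (simp add: reval_Sf)
  qed
next
  case (Proj i) show ?case
  proof (cases "i < length vs")
    case False then show ?thesis using sigma_False by (simp add: reval_Proj)
  next
    case True then show ?thesis using sigma_eq by (simp add: reval_Proj)
  qed
next
  case (Comp f gs)
  then show ?case using sigma_reval_Comp[of f gs vs "[]" r] by (simp add: reval_Comp)
next
  case (Prim f g)
  then show ?case by (rule sigma_reval_Prim)
next
  case (Mn f)
  obtain z where z: "z \<notin> set (r # vs)" using ex_fresh by blast
  obtain v where v: "v \<notin> set (z # r # vs)" using ex_fresh by blast
  \<comment> \<open>Variable v receives a value of f: first at the candidate r, where it is 0, then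
    at each smaller argument z, where it is not.\<close>
  have 1: "sigma_def (\<lambda>e. e v = 0 \<and> reval f (map e (r # vs)) (e v))"
    by (intro sigma_conj sigma_zero Mn)
  have 2: "sigma_def (\<lambda>e. e v \<noteq> 0 \<and> reval f (map e (z # vs)) (e v))"
    by (intro sigma_conj sigma_nonzero Mn)
  have "z \<noteq> r" using z by auto
  then have "sigma_def (\<lambda>e. (\<exists>a. (\<lambda>e. e v = 0 \<and> reval f (map e (r # vs)) (e v)) (e(v := a))) \<and>
    (\<forall>b<e r. (\<lambda>e. \<exists>a. (\<lambda>e. e v \<noteq> 0 \<and> reval f (map e (z # vs)) (e v)) (e(v := a))) (e(z := b))))"
    by (intro sigma_conj sigma_ex[OF 1] sigma_ball[OF sigma_ex[OF 2]])
  then show ?case using z v by (simp add: reval_Mn)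
qed

text \<open>The predecessor is found in variable 1 and copied back to variable 0, so
  \<open>ANum n\<close> recurs verbatim. Hence one fixed function takes the code of each numeral to
  that of the next.\<close>

primrec ANum :: "nat \<Rightarrow> af" where
  "ANum 0 = ANeg (AEx 1 (ALt 1 0))"
| "ANum (Suc n) = AEx 1 (AAnd (ASucc 2 1 0) (AEx 0 (AAnd (AEq 0 1) (ANum n))))"

lemma afv_ANum: "afv (ANum n) \<subseteq> {0}"
  by (induction n) auto

lemma aev_ANum: "e 0 < K \<Longrightarrow> aev K e (ANum n) \<longleftrightarrow> e 0 = n"
proof (induction n arbitrary: e)
  case 0 then show ?case by (auto intro: gr0I dest: less_trans)
next
  case (Suc n)
  have "aev K e (ANum (Suc n)) \<longleftrightarrow> (\<exists>a<K. aev K (e(1 := a)) (ASucc 2 1 0) \<and>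
     (\<exists>b<K. b = a \<and> aev K (e(1 := a, 0 := b)) (ANum n)))"
    unfolding ANum.simps fo.simps by (auto simp: linorder_not_less)
  also have "\<dots> \<longleftrightarrow> (\<exists>a<K. e 0 = Suc a \<and> a = n)"
    using aev_Suc[of 2 1 0 "e(1 := a)" K for a] Suc.IH Suc.prems by (auto simp del: fo.simps)
  also have "\<dots> \<longleftrightarrow> e 0 = Suc n" using Suc.prems by auto
  finally show ?case .
qed

lemma aev_exs_D:
  "aev K e (foldr AEx ws \<phi>) \<Longrightarrow> \<exists>e'. (\<forall>i. i \<notin> set ws \<longrightarrow> e' i = e i) \<and> (\<forall>i\<in>set ws. e' i < K) \<and> aev K e' \<phi>"
proof (induction ws arbitrary: e)
  case (Cons w ws)
  then obtain v where v: "v < K" "aev K (e(w := v)) (foldr AEx ws \<phi>)" by auto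
  then obtain e' where "\<forall>i. i \<notin> set ws \<longrightarrow> e' i = (e(w := v)) i" "\<forall>i\<in>set ws. e' i < K" "aev K e' \<phi>"
    using Cons.IH by blast
  then show ?case using v(1) by (intro exI[of _ e']) auto
qed auto

lemma aev_exs_I: "aev K e \<phi> \<Longrightarrow> \<forall>i\<in>set ws. e i < K \<Longrightarrow> aev K e (foldr AEx ws \<phi>)"
proof (induction ws)
  case (Cons w ws) then show ?case by (auto intro!: bexI[of _ "e w"])
qed simp

lemma afv_exs: "afv (foldr AEx ws \<phi>) = afv \<phi> - set ws"
  by (induction ws) auto

lemma finite_afv: "finite (afv \<phi>)" by (induction \<phi>) auto

text \<open>The argument is passed by binding variable 0 and equating it with n, which avoids
  computing substitutions on codes.\<close>

lemma sigma_unary: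
  assumes "sigma_def (\<lambda>e. P (e 0))"
  shows "\<exists>\<theta>. afv \<theta> \<subseteq> {0} \<and> (\<forall>n. (\<exists>K e. aev K e (AEx 0 (AAnd (ANum n) \<theta>))) \<longleftrightarrow> P n)"
proof -
  obtain \<phi> where p: "\<And>K e. (\<forall>i. e i < K) \<Longrightarrow> aev K e \<phi> \<Longrightarrow> P (e 0)"
    "\<And>e. P (e 0) \<Longrightarrow> \<exists>K0. \<forall>K\<ge>K0. (\<forall>i. e i < K) \<longrightarrow> aev K e \<phi>" using assms unfolding sigma_def_def by blast
  obtain ws where ws: "set ws = afv \<phi> - {0}" using finite_list[of "afv \<phi> - {0}"] finite_afv by blast
  define \<theta> where "\<theta> = foldr AEx ws \<phi>"
  have afv: "afv \<theta> \<subseteq> {0}" using ws by (auto simp: \<theta>_def afv_exs)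
  have "(\<exists>K e. aev K e (AEx 0 (AAnd (ANum n) \<theta>))) \<longleftrightarrow> P n" for n
  proof
    assume "\<exists>K e. aev K e (AEx 0 (AAnd (ANum n) \<theta>))"
    then obtain K e v where v: "v < K" "aev K (e(0 := v)) (ANum n)" "aev K (e(0 := v)) \<theta>" by auto
    then have n: "v = n" using aev_ANum[of "e(0 := v)" K n] by simp
    obtain e' where e': "\<forall>i. i \<notin> set ws \<longrightarrow> e' i = (e(0 := v)) i" "\<forall>i\<in>set ws. e' i < K" "aev K e' \<phi>"
      using aev_exs_D v(3) unfolding \<theta>_def by blast
    have e0: "e' 0 = n" using e' ws n by simp
    \<comment> \<open>\<open>sigma_def\<close> speaks only of assignments bounded by K, so the
      variables that do not occur free are reset to 0.\<close>
    define e'' where "e'' i = (if i \<in> insert 0 (set ws) then e' i else 0)" for i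
    have "aev K e'' \<phi>" using e'(3) fo_cong[of \<phi> e'' e'] ws by (auto simp: e''_def)
    moreover have "\<forall>i. e'' i < K" using e' e0 v n by (auto simp: e''_def)
    ultimately show "P n" using p(1)[of e'' K] e0 by (simp add: e''_def)
  next
    assume "P n"
    define e where "e i = (if i = 0 then n else 0)" for i :: nat
    obtain K0 where K0: "\<forall>K\<ge>K0. (\<forall>i. e i < K) \<longrightarrow> aev K e \<phi>" using p(2)[of e] \<open>P n\<close> by (auto simp: e_def)
    define K where "K = max K0 (Suc n)"
    have K: "\<forall>i. e i < K" "n < K" by (auto simp: e_def K_def)
    then have "aev K e \<phi>" using K0 by (simp add: K_def)
    then have "aev K e \<theta>" unfolding \<theta>_def using K by (intro aev_exs_I) auto
    moreover have "aev K e (ANum n)" using aev_ANum[of e K n] K by (simp add: e_def)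
    moreover have "e(0 := n) = e" by (auto simp: e_def)
    ultimately have "aev K e (AEx 0 (AAnd (ANum n) \<theta>))" using K by (auto intro!: bexI[of _ n])
    then show "\<exists>K e. aev K e (AEx 0 (AAnd (ANum n) \<theta>))" by blast
  qed
  then show ?thesis using afv by blast
qed

section \<open>Computability of the diagonal construction\<close>

definition computable :: "(nat \<Rightarrow> nat) \<Rightarrow> bool" where
  "computable g \<longleftrightarrow> (\<exists>f. \<forall>x. reval f [x] (g x))"

definition computable2 :: "(nat \<Rightarrow> nat \<Rightarrow> nat) \<Rightarrow> bool" where
  "computable2 g \<longleftrightarrow> (\<exists>f. \<forall>x y. reval f [x, y] (g x y))"

lemma reval_Comp1: "reval g xs y \<Longrightarrow> reval f [y] z \<Longrightarrow> reval (Comp f [g]) xs z"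
  by (auto simp: reval_Comp list_all2_Cons1)

lemma reval_Comp2: "reval g xs y \<Longrightarrow> reval h xs y' \<Longrightarrow> reval f [y, y'] z \<Longrightarrow> reval (Comp f [g, h]) xs z"
  by (auto simp: reval_Comp list_all2_Cons1)

lemma computable_id: "computable (\<lambda>x. x)"
  unfolding computable_def by (rule exI[of _ "Proj 0"]) (simp add: reval_Proj)

lemma computable_Suc: "computable g \<Longrightarrow> computable (\<lambda>x. Suc (g x))"
  unfolding computable_def by (blast intro: reval_Comp1 reval.intros(2))

lemma computable_const: "computable (\<lambda>x. c)"
proof (induction c)
  case 0 show ?case unfolding computable_def by (rule exI[of _ Zf]) (simp add: reval_Zf)
qed (rule computable_Suc)

lemma computable_comp2:
  "computable2 g \<Longrightarrow> computable h \<Longrightarrow> computable k \<Longrightarrow> computable (\<lambda>x. g (h x) (k x))"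
  unfolding computable_def computable2_def by (blast intro: reval_Comp2)

lemma computable2_add: "computable2 (+)"
  unfolding computable2_def
proof (intro exI allI)
  fix x y :: nat
  show "reval (Prim (Proj 0) (Comp Sf [Proj 0])) [x, y] (x + y)"
  proof (induction x)
    case 0 show ?case by (simp add: reval_Prim_0 reval_Proj)
  next
    case (Suc x)
    have "reval (Comp Sf [Proj 0]) [x + y, x, y] (Suc (x + y))"
      by (rule reval_Comp1[of _ _ "x + y"]) (simp_all add: reval_Proj reval_Sf)
    then show ?case using Suc unfolding reval_Prim_Suc by auto
  qed
qed

lemma computable_rec:
  assumes "computable2 T" "\<And>n. f (Suc n) = T (f n) n" shows "computable f"
proof -
  obtain t where t: "\<And>x y. reval t [x, y] (T x y)" using assms(1) unfolding computable2_def by blast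
  \<comment> \<open>With the recursion variable as only argument, \<open>Prim\<close> calls its base
    function on the empty list.\<close>
  obtain c where c: "reval c [] (f 0)"
  proof -
    have "\<exists>c. reval c [] m" for m
    proof (induction m)
      case 0 show ?case by (rule exI[of _ Zf]) (simp add: reval_Zf)
    next
      case (Suc m)
      then show ?case using reval_Comp1[of _ "[]" m Sf "Suc m"] by (auto simp: reval_Sf)
    qed
    then show thesis using that by blast
  qed
  have "reval (Prim c t) [n] (f n)" for n
  proof (induction n)
    case 0 show ?case using c by (simp add: reval_Prim_0)
  next
    case (Suc n) show ?case unfolding reval_Prim_Suc using Suc t assms(2) by metis
  qed
  then show ?thesis unfolding computable_def by blast
qed

lemma computable2_fst: assumes "computable T" shows "computable2 (\<lambda>x y. T x)"
proof -
  obtain t where "\<And>x. reval t [x] (T x)" using assms unfolding computable_def by blast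
  then have "reval (Comp t [Proj 0]) [x, y] (T x)" for x y
    by (intro reval_Comp1[of _ _ x]) (simp_all add: reval_Proj)
  then show ?thesis unfolding computable2_def by blast
qed

lemma computable_triangle: "computable triangle"
proof (rule computable_rec)
  obtain a where a: "\<And>x y. reval a [x, y] (x + y)" using computable2_add unfolding computable2_def by blast
  have "reval (Comp Sf [a]) [z, n] (z + Suc n)" for z n
    by (rule reval_Comp1[OF a]) (simp add: reval_Sf)
  then show "computable2 (\<lambda>z n. z + Suc n)" unfolding computable2_def by blast
qed simp

lemma computable_comp: "computable g \<Longrightarrow> computable h \<Longrightarrow> computable (\<lambda>x. g (h x))"
  unfolding computable_def by (blast intro: reval_Comp1)

lemma computable_prod_encode:
  assumes "computable h" "computable k" shows "computable (\<lambda>x. prod_encode (h x, k x))"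
  unfolding prod_encode_def prod.case
  by (intro computable_comp2[OF computable2_add] computable_comp[OF computable_triangle] assms)

lemma computable_numeral_code: "computable (\<lambda>n. fcode (tr (ANum n)))"
proof -
  \<comment> \<open>The effect on codes of passing from \<open>ANum n\<close> to
    \<open>ANum (Suc n)\<close>: the tag 4 is \<open>Ex\<close>, followed by the shifted variable 5
    or 4, and the tag 3 is \<open>Conj\<close>; each quantifier brings its guard
    \<open>vertexF\<close>.\<close>
  define T where "T c = prod_encode (4, prod_encode (5, prod_encode (3, prod_encode (fcode (vertexF 5),
     prod_encode (3, prod_encode (fcode (tr (ASucc 2 1 0)), prod_encode (4, prod_encode (4,
     prod_encode (3, prod_encode (fcode (vertexF 4), prod_encode (3,
       prod_encode (fcode (tr (AEq 0 1)), c))))))))))))" for c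
  have T: "computable T" unfolding T_def
    by (intro computable_prod_encode computable_const computable_id)
  show ?thesis
    by (rule computable_rec[OF computable2_fst[OF T]]) (simp add: T_def)
qed

section \<open>The diagonal sentence\<close>

lemma tcode_inject: "tcode s = tcode t \<Longrightarrow> s = t"
proof (induction s arbitrary: t)
  case (Var x) then show ?case by (cases t) auto
next
  case Lam then show ?case by (cases t) auto
next
  case (Dm i s) then show ?case by (cases t) auto
qed

lemma fcode_inject: "fcode \<phi> = fcode \<psi> \<Longrightarrow> \<phi> = \<psi>"
proof (induction \<phi> arbitrary: \<psi>)
  case (Eq s t) then show ?case by (cases \<psi>) (auto dest: tcode_inject)
next
  case (Lt s t) then show ?case by (cases \<psi>) (auto dest: tcode_inject)
next
  case (Neg \<phi>) then show ?case by (cases \<psi>) auto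
next
  case (Conj \<phi> \<phi>') then show ?case by (cases \<psi>) auto
next
  case (Ex x \<phi>) then show ?case by (cases \<psi>) auto
qed

definition diagonal :: "af \<Rightarrow> nat \<Rightarrow> fm" where
  "diagonal \<theta> n = sentence (AEx 0 (AAnd (ANum n) \<theta>))"

lemma computable_diagonal_code:
  "\<exists>G. computable G \<and> (\<forall>\<theta>. G (fcode (tr \<theta>)) = fcode (diagonal \<theta> (fcode (tr \<theta>))))"
proof -
  \<comment> \<open>Here n enters twice, as the number of the numeral and as the code of the formula
    it is fed to. This is the self-application, done on codes without decoding.\<close>
  define G where "G n = prod_encode (4, prod_encode (0, prod_encode (3, prod_encode (fcode (tr bit_axiom),
    prod_encode (4, prod_encode (4, prod_encode (3, prod_encode (fcode (vertexF 4),
      prod_encode (3, prod_encode (fcode (tr (ANum n)), n))))))))))" for n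
  have "computable G" unfolding G_def
    by (intro computable_prod_encode computable_const computable_id computable_numeral_code)
  moreover have "G (fcode (tr \<theta>)) = fcode (diagonal \<theta> (fcode (tr \<theta>)))" for \<theta>
    by (simp add: G_def diagonal_def sentence_def)
  ultimately show ?thesis by blast
qed

theorem theorem2:
  fixes \<alpha> :: enat
  assumes "3 \<le> \<alpha>"
  shows "\<not> decidable_set (fcode ` Th \<alpha>)"
proof
  assume "decidable_set (fcode ` Th \<alpha>)"
  then obtain d where d: "\<And>n. reval d [n] (if n \<in> fcode ` Th \<alpha> then 1 else 0)"
    unfolding decidable_set_def by blast
  obtain G where G: "computable G" "\<And>\<theta>. G (fcode (tr \<theta>)) = fcode (diagonal \<theta> (fcode (tr \<theta>)))"
    using computable_diagonal_code by blast
  obtain g where g: "\<And>n. reval g [n] (G n)" using G(1) unfolding computable_def by blast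
  define h where "h = Comp d [g]"
  have h: "reval h [n] 0 \<longleftrightarrow> G n \<notin> fcode ` Th \<alpha>" for n
  proof -
    have "reval h [n] (if G n \<in> fcode ` Th \<alpha> then 1 else 0)"
      unfolding h_def by (rule reval_Comp1[OF g d])
    then show ?thesis using reval_det by (metis zero_neq_one)
  qed
  \<comment> \<open>\<open>sigma_reval\<close> expects the output in a variable, so variable 1 is
    fixed to 0 and then quantified away.\<close>
  have "sigma_def (\<lambda>e. e 1 = 0 \<and> reval h (map e [0]) (e 1))"
    by (intro sigma_conj sigma_zero sigma_reval)
  then have "sigma_def (\<lambda>e. \<exists>v. (\<lambda>e. e 1 = 0 \<and> reval h (map e [0]) (e 1)) (e(1 := v)))"
    by (rule sigma_ex)
  then have "sigma_def (\<lambda>e. reval h [e 0] 0)" by simp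
  then obtain \<theta> where \<theta>: "afv \<theta> \<subseteq> {0}"
    "\<And>n. (\<exists>K e. aev K e (AEx 0 (AAnd (ANum n) \<theta>))) \<longleftrightarrow> reval h [n] 0"
    using sigma_unary[of "\<lambda>n. reval h [n] 0"] by blast
  \<comment> \<open>For this m the formula speaks about its own instance: \<open>G m\<close> is the
    code of \<open>diagonal \<theta> m\<close>.\<close>
  define m where "m = fcode (tr \<theta>)"
  have "afv (AEx 0 (AAnd (ANum m) \<theta>)) = {}" using \<theta>(1) afv_ANum by fastforce
  then have "diagonal \<theta> m \<in> Th \<alpha> \<longleftrightarrow> reval h [m] 0"
    unfolding diagonal_def using sentence_in_Th[OF assms] \<theta>(2) by blast
  also have "\<dots> \<longleftrightarrow> fcode (diagonal \<theta> m) \<notin> fcode ` Th \<alpha>" unfolding h m_def G(2) ..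
  also have "\<dots> \<longleftrightarrow> diagonal \<theta> m \<notin> Th \<alpha>" using fcode_inject by blast
  finally show False by blast
qed

end
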